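(* Let $H$ be an infinite dimensional complex Hilbert space and $T \in \mathcal{B}(H)$. Then the following are equivalent. (1) $T \in \mathcal{AN}(H)_{+}$. (2) $T$ is self-adjoint and there exists $\alpha \geq 0$ such that $(T-\alpha I)^+ \in \mathcal{K}(H)_+$, $(T - \alpha I)^- \in \mathcal{F}(H)_+$ and $\|(T-\alpha I)^{-}\|\leq \alpha$.
   Context: $\mathcal{B}(H)$ is the space of bounded linear operators on $H$; $\mathcal{K}(H)$ and $\mathcal{F}(H)$ are the sets of compact and of finite rank operators in $\mathcal{B}(H)$. For $\mathcal{A}\subseteq\mathcal{B}(H)$, $\mathcal{A}_+$ is the set of positive operators in $\mathcal{A}$ (positive means self-adjoint with $\langle Tx,x\rangle\ge0$ for all $x$). An operator is norm attaining if its norm is attained at some unit vector of its domain. $T\in\mathcal{B}(H)$ is absolutely norm attaining (an $\mathcal{AN}$-operator) if for every nonzero closed subspace $M$ of $H$ the restriction $T|_M:M\to H$ is norm attaining; $\mathcal{AN}(H)$ is the set of such operators. For self-adjoint $S$, $|S|=(S^*S)^{1/2}$, $S^+=\frac{|S|+S}{2}$, $S^-=\frac{|S|-S}{2}$. *)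

theory Defs
  imports "HOL-Analysis.Analysis"
begin

class complex_vector = real_vector +
  fixes scaleC :: "complex \<Rightarrow> 'a \<Rightarrow> 'a"  (infixr \<open>*\<^sub>C\<close> 75)
  assumes scaleC_add_right: "a *\<^sub>C (x + y) = a *\<^sub>C x + a *\<^sub>C y"
    and scaleC_add_left: "(a + b) *\<^sub>C x = a *\<^sub>C x + b *\<^sub>C x"
    and scaleC_scaleC: "a *\<^sub>C b *\<^sub>C x = (a * b) *\<^sub>C x"
    and scaleC_of_real: "complex_of_real r *\<^sub>C x = r *\<^sub>R x"

global_interpretation complex_vector:
  vector_space "scaleC :: complex \<Rightarrow> 'a \<Rightarrow> 'a :: complex_vector"
  defines csubspace = complex_vector.subspace
    and cspan = complex_vector.span
proof
  show "1 *\<^sub>C x = x" for x :: 'a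
    using scaleC_of_real[of 1 x] by simp
qed (simp_all add: scaleC_add_right scaleC_add_left scaleC_scaleC)

(* The inner product is linear in its first argument. *)
class complex_inner = complex_vector + real_normed_vector +
  fixes cinner :: "'a \<Rightarrow> 'a \<Rightarrow> complex"
  assumes cinner_commute: "cinner x y = cnj (cinner y x)"
    and cinner_add_left: "cinner (x + y) z = cinner x z + cinner y z"
    and cinner_scaleC_left: "cinner (a *\<^sub>C x) y = a * cinner x y"
    and cinner_self_nonneg: "0 \<le> Re (cinner x x)"
    and cinner_self_eq_zero: "cinner x x = 0 \<longleftrightarrow> x = 0"
    and norm_eq_sqrt_cinner: "norm x = sqrt (Re (cinner x x))"

class complex_hilbert = complex_inner + complete_space

definition cfinite_dim :: "'a::complex_vector set \<Rightarrow> bool"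
  where "cfinite_dim V \<longleftrightarrow> (\<exists>B. finite B \<and> V = cspan B)"

(* B(H).  Operators are functions; their norm is the library's onorm. *)
definition bounded_ops :: "('a::complex_hilbert \<Rightarrow> 'a) set"
  where "bounded_ops = {T. bounded_linear T \<and> (\<forall>c x. T (c *\<^sub>C x) = c *\<^sub>C T x)}"

definition compact_ops :: "('a::complex_hilbert \<Rightarrow> 'a) set"
  where "compact_ops = {T \<in> bounded_ops. compact (closure (T ` cball 0 1))}"

definition finite_rank_ops :: "('a::complex_hilbert \<Rightarrow> 'a) set"
  where "finite_rank_ops = {T \<in> bounded_ops. cfinite_dim (range T)}"

definition hadjoint :: "('a::complex_hilbert \<Rightarrow> 'a) \<Rightarrow> 'a \<Rightarrow> 'a"
  where "hadjoint T = (THE S. S \<in> bounded_ops \<and> (\<forall>x y. cinner (T x) y = cinner x (S y)))"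

definition self_adjoint :: "('a::complex_hilbert \<Rightarrow> 'a) \<Rightarrow> bool"
  where "self_adjoint T \<longleftrightarrow> T \<in> bounded_ops \<and> hadjoint T = T"

definition positive_op :: "('a::complex_hilbert \<Rightarrow> 'a) \<Rightarrow> bool"
  where "positive_op T \<longleftrightarrow> self_adjoint T \<and> (\<forall>x. cinner (T x) x \<in> \<real>\<^sub>\<ge>\<^sub>0)"

definition positives :: "('a::complex_hilbert \<Rightarrow> 'a) set \<Rightarrow> ('a \<Rightarrow> 'a) set"  (\<open>_\<^sub>+\<close> [1000] 1000)
  where "A\<^sub>+ = {T \<in> A. positive_op T}"

(* The positive square root; meaningful only for positive P. *)
definition sqrt_op :: "('a::complex_hilbert \<Rightarrow> 'a) \<Rightarrow> 'a \<Rightarrow> 'a"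
  where "sqrt_op P = (THE R. positive_op R \<and> R \<circ> R = P)"

definition abs_op :: "('a::complex_hilbert \<Rightarrow> 'a) \<Rightarrow> 'a \<Rightarrow> 'a"
  where "abs_op S = sqrt_op (hadjoint S \<circ> S)"

definition pos_part :: "('a::complex_hilbert \<Rightarrow> 'a) \<Rightarrow> 'a \<Rightarrow> 'a"
  where "pos_part S = (\<lambda>x. (1/2) *\<^sub>C (abs_op S x + S x))"

definition neg_part :: "('a::complex_hilbert \<Rightarrow> 'a) \<Rightarrow> 'a \<Rightarrow> 'a"
  where "neg_part S = (\<lambda>x. (1/2) *\<^sub>C (abs_op S x - S x))"

(* The norm of the restriction of T to M; onorm_on UNIV is onorm. *)
definition onorm_on :: "'a::complex_hilbert set \<Rightarrow> ('a \<Rightarrow> 'a) \<Rightarrow> real"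
  where "onorm_on M T = (SUP x\<in>M. norm (T x) / norm x)"

definition norm_attaining_on :: "'a::complex_hilbert set \<Rightarrow> ('a \<Rightarrow> 'a) \<Rightarrow> bool"
  where "norm_attaining_on M T \<longleftrightarrow> (\<exists>x\<in>M. norm x = 1 \<and> norm (T x) = onorm_on M T)"

definition AN_ops :: "('a::complex_hilbert \<Rightarrow> 'a) set"
  where "AN_ops = {T \<in> bounded_ops.
    \<forall>M. csubspace M \<and> closed M \<and> M \<noteq> {0} \<longrightarrow> norm_attaining_on M T}"

end

theory Submission
  imports Defs
begin

text \<open>If \<open>T = \<alpha> + K - F\<close> with \<open>K\<close> compact, \<open>F\<close> of finite rank and both positive, and the supremum of \<open>\<parallel>T x\<parallel>\<close>
  over the unit sphere of a closed subspace \<open>M\<close> exceeds \<open>\<alpha>\<close>, then compactness of \<open>T\<^sup>2 - \<alpha>\<^sup>2\<close> makes a maximizing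
  sequence converge. Otherwise either \<open>M\<close> meets \<open>ker F\<close>, where \<open>\<parallel>T x\<parallel> \<ge> \<alpha> \<parallel>x\<parallel>\<close>, or \<open>M\<close> is finite dimensional.

  Conversely, a positive \<open>\<A>\<N>\<close>-operator has a top eigenvector on every nonzero closed invariant subspace.
  Choosing top eigenvectors successively gives orthonormal \<open>e\<^sub>n\<close> with eigenvalues decreasing to some \<open>\<alpha>\<close>; then
  \<open>T - \<alpha>\<close> is compact and positive on the closed span of the \<open>e\<^sub>n\<close> and nonpositive on its complement.
  If it had infinite rank there, a second such sequence with eigenvalues bounded away from \<open>\<alpha>\<close> would exist, and
  suitable combinations of the two sequences would span a subspace on which \<open>T\<close> does not attain its norm.\<close>


section \<open>Inner products and quadratic forms\<close>

text \<open>No spectral theorem is invoked: eigenvectors come from extremal vectors, through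
  Cauchy-Schwarz for the form of \<open>c - T^2\<close>. That form makes sense on subspaces which T
  does not preserve, and the norm attaining condition ranges over those too. In the converse,
  nothing in the construction controls T below \<alpha>, so finite rank has to come from a
  contradiction. A form that is diagonal with strictly increasing entries has no maximizing vector,
  and pairing one vector of each sequence with suitable weights produces such a form. The
  eigenvalues of the second sequence decrease, so keeping them away from \<alpha> only requires the
  first one to differ from \<alpha>; the eigenspace of \<alpha> is removed beforehand for this
  reason. T - \<alpha> is split along two invariant subspaces. Since absolute values are given by
  description, uniqueness of positive square roots is what identifies the two pieces with the
  positive and the negative part. The bound by \<alpha> on the negative part expresses T \<ge> 0 on
  the subspace where T lies below \<alpha>.\<close>

lemma cinner_add_right: "cinner x (y + z) = cinner x y + cinner x (z::'a::complex_inner)"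
  by (metis cinner_add_left cinner_commute complex_cnj_add)

lemma cinner_scaleC_right: "cinner x (a *\<^sub>C y) = cnj a * cinner x (y::'a::complex_inner)"
  by (metis cinner_commute cinner_scaleC_left complex_cnj_mult)

lemma cinner_zero_left [simp]: "cinner 0 (x::'a::complex_inner) = 0"
  using cinner_add_left[of 0 0 x] by simp

lemma cinner_zero_right [simp]: "cinner x (0::'a::complex_inner) = 0"
  using cinner_add_right[of x 0 0] by simp

lemma cinner_minus_left: "cinner (- x) y = - cinner x (y::'a::complex_inner)"
  using cinner_add_left[of x "- x" y] by (simp add: eq_neg_iff_add_eq_0 add.commute)

lemma cinner_minus_right: "cinner x (- y) = - cinner x (y::'a::complex_inner)"
  using cinner_add_right[of x y "- y"] by (simp add: eq_neg_iff_add_eq_0 add.commute)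

lemma cinner_diff_left: "cinner (x - y) z = cinner x z - cinner y (z::'a::complex_inner)"
  using cinner_add_left[of x "- y" z] by (simp add: cinner_minus_left)

lemma cinner_diff_right: "cinner x (y - z) = cinner x y - cinner x (z::'a::complex_inner)"
  using cinner_add_right[of x y "- z"] by (simp add: cinner_minus_right)

lemma cinner_scaleR_left: "cinner (r *\<^sub>R x) y = of_real r * cinner x (y::'a::complex_inner)"
  by (metis cinner_scaleC_left scaleC_of_real)

lemma cinner_scaleR_right: "cinner x (r *\<^sub>R y) = of_real r * cinner x (y::'a::complex_inner)"
  by (metis cinner_scaleC_right scaleC_of_real complex_cnj_complex_of_real)

lemmas cinner_simps = cinner_add_left cinner_add_right cinner_diff_left cinner_diff_right
  cinner_minus_left cinner_minus_right cinner_scaleC_left cinner_scaleC_right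
  cinner_scaleR_left cinner_scaleR_right

lemma cinner_self: "cinner x x = complex_of_real ((norm (x::'a::complex_inner))\<^sup>2)"
proof -
  have "Im (cinner x x) = 0"
    using arg_cong[OF cinner_commute[of x x], of Im] by simp
  then show ?thesis
    by (simp add: complex_eq_iff norm_eq_sqrt_cinner cinner_self_nonneg)
qed

lemma Re_cinner_commute: "Re (cinner x y) = Re (cinner y (x::'a::complex_inner))"
  by (subst cinner_commute) simp

lemma cinner_eq_zero_commute: "cinner x y = 0 \<longleftrightarrow> cinner y (x::'a::complex_inner) = 0"
  by (metis cinner_commute complex_cnj_zero)

lemma norm_scaleC: "norm (a *\<^sub>C x) = cmod a * norm (x::'a::complex_inner)"
proof -
  have "complex_of_real ((norm (a *\<^sub>C x))\<^sup>2) = complex_of_real ((cmod a * norm x)\<^sup>2)"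
    by (simp only: cinner_self[symmetric] cinner_simps)
       (simp add: cinner_self complex_norm_square power_mult_distrib mult_ac del: of_real_power)
  then show ?thesis
    by (simp only: of_real_eq_iff power2_eq_iff_nonneg norm_ge_zero mult_nonneg_nonneg)
qed

lemma norm_add_square: "(norm (x + y))\<^sup>2 = (norm x)\<^sup>2 + 2 * Re (cinner x y) + (norm (y::'a::complex_inner))\<^sup>2"
proof -
  have "complex_of_real ((norm (x + y))\<^sup>2) = cinner (x + y) (x + y)" by (rule cinner_self[symmetric])
  also have "\<dots> = complex_of_real ((norm x)\<^sup>2) + (cinner x y + cinner y x) + complex_of_real ((norm y)\<^sup>2)"
    by (simp only: cinner_add_left cinner_add_right) (simp only: cinner_self add_ac)
  finally show ?thesis
    by (simp add: complex_eq_iff Re_cinner_commute[of y x])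
qed

lemma norm_diff_square: "(norm (x - y))\<^sup>2 = (norm x)\<^sup>2 - 2 * Re (cinner x y) + (norm (y::'a::complex_inner))\<^sup>2"
  using norm_add_square[of x "- y"] by (simp add: cinner_simps)

lemma pythagoras: "cinner x y = 0 \<Longrightarrow> (norm (x + y))\<^sup>2 = (norm x)\<^sup>2 + (norm (y::'a::complex_inner))\<^sup>2"
  by (simp add: norm_add_square)

section \<open>Linear and symmetric operators and their quadratic forms\<close>

definition clinear_op :: "('a::complex_inner \<Rightarrow> 'a) \<Rightarrow> bool"
  where "clinear_op A \<longleftrightarrow> Vector_Spaces.linear (*\<^sub>C) (*\<^sub>C) A"

definition symmetric_op :: "('a::complex_inner \<Rightarrow> 'a) \<Rightarrow> bool"
  where "symmetric_op A \<longleftrightarrow> (\<forall>x y. cinner (A x) y = cinner x (A y))"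

lemma clinear_opI:
  assumes "\<And>x y. A (x + y) = A x + A y" "\<And>c x. A (c *\<^sub>C x) = c *\<^sub>C A x"
  shows "clinear_op A"
  unfolding clinear_op_def by unfold_locales (use assms in auto)

lemma
  assumes "clinear_op A"
  shows clinear_op_add: "A (x + y) = A x + A y"
    and clinear_op_diff: "A (x - y) = A x - A y"
    and clinear_op_minus: "A (- x) = - A x"
    and clinear_op_scaleC: "A (c *\<^sub>C x) = c *\<^sub>C A x"
    and clinear_op_scaleR: "A (r *\<^sub>R x) = r *\<^sub>R A x"
    and clinear_op_zero: "A 0 = 0"
proof -
  interpret Vector_Spaces.linear "(*\<^sub>C)" "(*\<^sub>C)" A using assms by (simp add: clinear_op_def)
  show "A (x + y) = A x + A y" by (rule add)
  show "A (x - y) = A x - A y" by (rule diff)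
  show "A (- x) = - A x" by (rule neg)
  show "A (c *\<^sub>C x) = c *\<^sub>C A x" by (rule scale)
  show "A (r *\<^sub>R x) = r *\<^sub>R A x" using scale[of "complex_of_real r" x] by (simp add: scaleC_of_real)
  show "A 0 = 0" by (rule zero)
qed

lemmas clinear_op_simps = clinear_op_add clinear_op_diff clinear_op_minus clinear_op_scaleC
  clinear_op_scaleR clinear_op_zero

lemma symmetric_opD: "symmetric_op A \<Longrightarrow> cinner (A x) y = cinner x (A y)"
  by (simp add: symmetric_op_def)

lemma cinner_symmetric_op_self: "symmetric_op A \<Longrightarrow> cinner (A x) x = complex_of_real (Re (cinner (A x) x))"
  by (metis Reals_cnj_iff cinner_commute of_real_Re symmetric_opD)

text \<open>The discriminant argument; only positivity of the form on the subspace is used,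
  so the inequality also applies to the forms that measure the defect from a supremum over a subspace.\<close>

lemma psd_Cauchy_Schwarz:
  assumes lin: "clinear_op A" and sym: "symmetric_op A" and M: "csubspace M"
    and pos: "\<And>z. z \<in> M \<Longrightarrow> 0 \<le> Re (cinner (A z) z)" and x: "x \<in> M" and y: "y \<in> M"
  shows "(cmod (cinner (A x) y))\<^sup>2 \<le> Re (cinner (A x) x) * Re (cinner (A y) y)"
proof -
  define a where "a = Re (cinner (A x) x)"
  define b where "b = Re (cinner (A y) y)"
  define w where "w = cinner (A x) y"
  have aa: "cinner (A x) x = of_real a" and bb: "cinner (A y) y = of_real b"
    using cinner_symmetric_op_self[OF sym] by (auto simp: a_def b_def)
  have w': "cinner (A y) x = cnj w"
    unfolding w_def using symmetric_opD[OF sym] cinner_commute by metis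
  have q: "0 \<le> a - 2 * t * (cmod w)\<^sup>2 + t\<^sup>2 * (cmod w)\<^sup>2 * b" for t :: real
  proof -
    \<comment> \<open>The factor w cancels the phase, so the form becomes a real quadratic in
      t.\<close>
    define c where "c = of_real t * w"
    have "x - c *\<^sub>C y \<in> M"
      by (intro complex_vector.subspace_diff complex_vector.subspace_scale M x y)
    then have "0 \<le> Re (cinner (A (x - c *\<^sub>C y)) (x - c *\<^sub>C y))" by (rule pos)
    also have "cinner (A (x - c *\<^sub>C y)) (x - c *\<^sub>C y) = of_real a - cnj c * w - c * cnj w + c * cnj c * of_real b"
      by (simp add: clinear_op_simps[OF lin] cinner_simps aa bb w' w_def[symmetric] algebra_simps)
    also have "Re \<dots> = a - 2 * t * (cmod w)\<^sup>2 + t\<^sup>2 * (cmod w)\<^sup>2 * b"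
      unfolding c_def cmod_power2 by (simp add: power2_eq_square algebra_simps)
    finally show ?thesis .
  qed
  have b0: "0 \<le> b" using pos[OF y] by (simp add: b_def)
  have "(cmod w)\<^sup>2 \<le> a * b"
  proof (cases "b = 0")
    case True
    have "(cmod w)\<^sup>2 \<le> 0"
    proof (rule ccontr)
      assume "\<not> (cmod w)\<^sup>2 \<le> 0"
      then have "0 < (cmod w)\<^sup>2" by simp
      \<comment> \<open>With \<open>b = 0\<close> the bound is affine in t, and this t gives the
        value -1.\<close>
      then show False using q[of "(a + 1) / (2 * (cmod w)\<^sup>2)"] True by simp
    qed
    then show ?thesis using True by simp
  next
    case False
    then have "0 < b" using b0 by simp
    \<comment> \<open>\<open>1 / b\<close> is the minimizer of the quadratic in t.\<close>
    then show ?thesis using q[of "1 / b"] by (simp add: field_simps power2_eq_square)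
  qed
  then show ?thesis by (simp add: a_def b_def w_def)
qed

lemma clinear_op_id: "clinear_op (\<lambda>x. x)"
  by (rule clinear_opI) auto

lemma cmod_cinner_le: "cmod (cinner x y) \<le> norm x * norm (y::'a::complex_inner)"
proof -
  have "(cmod (cinner x y))\<^sup>2 \<le> (norm x * norm y)\<^sup>2"
    using psd_Cauchy_Schwarz[of "\<lambda>x. x" UNIV x y]
    by (simp add: clinear_op_id symmetric_op_def cinner_self power_mult_distrib)
  then show ?thesis by (rule power2_le_imp_le) simp
qed

lemma Re_cinner_le: "Re (cinner x y) \<le> norm x * norm (y::'a::complex_inner)"
  using cmod_cinner_le[of x y] complex_Re_le_cmod[of "cinner x y"] by linarith

lemma bounded_bilinear_cinner: "bounded_bilinear (cinner :: 'a::complex_inner \<Rightarrow> 'a \<Rightarrow> complex)"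
  by (rule bounded_bilinear.intro)
     (auto simp: cinner_simps scaleR_conv_of_real intro!: exI[of _ 1] cmod_cinner_le)

lemmas continuous_on_cinner = bounded_bilinear.continuous_on[OF bounded_bilinear_cinner]

text \<open>Reality of the form at \<open>x + y\<close> controls the imaginary parts of the mixed
  terms, reality at \<open>x + \<i> *\<^sub>C y\<close> the real parts.\<close>

lemma symmetric_opI_real:
  assumes lin: "clinear_op A" and real: "\<And>x. cinner (A x) x \<in> \<real>"
  shows "symmetric_op A"
  unfolding symmetric_op_def
proof (intro allI)
  fix x y
  have im: "Im (cinner (A z) z) = 0" for z using real[of z] by (simp add: complex_is_Real_iff)
  have 1: "Im (cinner (A x) y) + Im (cinner (A y) x) = 0"
    using im[of "x + y"] im[of x] im[of y] by (simp add: clinear_op_simps[OF lin] cinner_simps)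
  have 2: "Re (cinner (A y) x) - Re (cinner (A x) y) = 0"
    using im[of "x + \<i> *\<^sub>C y"] im[of x] im[of y] by (simp add: clinear_op_simps[OF lin] cinner_simps)
  have "cinner (A x) y = cnj (cinner (A y) x)" using 1 2 by (simp add: complex_eq_iff)
  then show "cinner (A x) y = cinner x (A y)" using cinner_commute by metis
qed

text \<open>Cauchy-Schwarz for the pair x, \<open>A x\<close> bounds \<open>A^2\<close> by
  \<open>c A\<close> in the sense of forms; invariance keeps \<open>A x\<close> in M, where the
  bounds apply. This converts bounds on quadratic forms into bounds on norms.\<close>

lemma psd_norm_le:
  assumes lin: "clinear_op A" and sym: "symmetric_op A" and M: "csubspace M"
    and inv: "\<And>z. z \<in> M \<Longrightarrow> A z \<in> M"
    and pos: "\<And>z. z \<in> M \<Longrightarrow> 0 \<le> Re (cinner (A z) z)"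
    and le: "\<And>z. z \<in> M \<Longrightarrow> Re (cinner (A z) z) \<le> c * (norm z)\<^sup>2" and x: "x \<in> M"
  shows "(norm (A x))\<^sup>2 \<le> c * Re (cinner (A x) x)" and "0 \<le> c \<Longrightarrow> norm (A x) \<le> c * norm x"
proof -
  define n where "n = (norm (A x))\<^sup>2"
  have "n\<^sup>2 = (cmod (cinner (A x) (A x)))\<^sup>2"
    by (simp only: cinner_self n_def norm_of_real) simp
  also have "\<dots> \<le> Re (cinner (A x) x) * Re (cinner (A (A x)) (A x))"
    using assms by (intro psd_Cauchy_Schwarz[where M = M]) auto
  also have "\<dots> \<le> Re (cinner (A x) x) * (c * n)"
    unfolding n_def using x inv pos le by (intro mult_left_mono) auto
  finally have *: "n * n \<le> (c * Re (cinner (A x) x)) * n" by (simp add: power2_eq_square mult_ac)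
  show 1: "(norm (A x))\<^sup>2 \<le> c * Re (cinner (A x) x)"
  proof (cases "n = 0")
    case True
    \<comment> \<open>The first claim does not assume a sign for c; a nonzero x forces
      \<open>0 \<le> c\<close> through the two form bounds.\<close>
    have "0 \<le> c * Re (cinner (A x) x)"
    proof (cases "x = 0")
      case False
      then have "0 \<le> c" using pos[OF x] le[OF x] by (metis order_trans zero_le_mult_iff zero_less_norm_iff zero_less_power not_less mult_neg_pos)
      then show ?thesis using pos[OF x] by simp
    qed simp
    then show ?thesis using True by (simp add: n_def)
  next
    case False
    then have "0 < n" by (simp add: n_def)
    then show ?thesis using * unfolding n_def[symmetric] by (rule mult_right_le_imp_le[rotated])
  qed
  assume c: "0 \<le> c"
  have "(norm (A x))\<^sup>2 \<le> c * (c * (norm x)\<^sup>2)" using 1 mult_left_mono[OF le[OF x] c] by linarith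
  then have "(norm (A x))\<^sup>2 \<le> (c * norm x)\<^sup>2" by (simp add: power2_eq_square mult_ac)
  then show "norm (A x) \<le> c * norm x" by (rule power2_le_imp_le) (simp add: c)
qed


section \<open>Orthogonal projections and finite dimensional subspaces\<close>

definition orth :: "'a::complex_inner set \<Rightarrow> 'a set"
  where "orth S = {x. \<forall>y\<in>S. cinner x y = 0}"

lemma orthI: "(\<And>y. y \<in> S \<Longrightarrow> cinner x y = 0) \<Longrightarrow> x \<in> orth S"
  and orthD: "x \<in> orth S \<Longrightarrow> y \<in> S \<Longrightarrow> cinner x y = 0"
  and orthD': "x \<in> orth S \<Longrightarrow> y \<in> S \<Longrightarrow> cinner y x = 0"
  by (auto simp: orth_def cinner_eq_zero_commute)

lemma csubspace_orth: "csubspace (orth S)"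
  by (rule complex_vector.subspaceI) (auto simp: orth_def cinner_simps)

lemma closed_orth: "closed (orth S)"
proof -
  have "orth S = (\<Inter>y\<in>S. {x. cinner x y = 0})" by (auto simp: orth_def)
  moreover have "closed {x. cinner x y = 0}" for y :: 'a
    by (intro closed_Collect_eq continuous_on_cinner continuous_intros)
  ultimately show ?thesis by auto
qed

lemma orth_Int_self: "x \<in> orth M \<Longrightarrow> x \<in> M \<Longrightarrow> x = 0"
  using cinner_self_eq_zero orthD by blast

lemma bounded_bilinear_scaleC: "bounded_bilinear (scaleC :: complex \<Rightarrow> 'a::complex_inner \<Rightarrow> 'a)"
proof (rule bounded_bilinear.intro)
  show "(r *\<^sub>R a) *\<^sub>C b = r *\<^sub>R a *\<^sub>C b" for r a and b :: 'a
    by (simp add: scaleR_conv_of_real scaleC_of_real[symmetric] scaleC_scaleC)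
  show "a *\<^sub>C (r *\<^sub>R b) = r *\<^sub>R a *\<^sub>C b" for r a and b :: 'a
    by (simp add: scaleC_of_real[symmetric] scaleC_scaleC mult.commute)
qed (auto simp: scaleC_add_left scaleC_add_right norm_scaleC intro!: exI[of _ 1])

lemma csubspace_closure:
  assumes "csubspace (V :: 'a::complex_inner set)"
  shows "csubspace (closure V)"
proof (rule complex_vector.subspaceI)
  show "0 \<in> closure V"
    using complex_vector.subspace_0[OF assms] closure_subset by blast
  fix x y assume "x \<in> closure V" "y \<in> closure V"
  then obtain f g where f: "\<And>n. f n \<in> V" "f \<longlonglongrightarrow> x" and g: "\<And>n. g n \<in> V" "g \<longlonglongrightarrow> y"
    unfolding closure_sequential by blast
  have "\<forall>n. f n + g n \<in> V" using f g complex_vector.subspace_add[OF assms] by blast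
  moreover have "(\<lambda>n. f n + g n) \<longlonglongrightarrow> x + y" using f g by (intro tendsto_add)
  ultimately show "x + y \<in> closure V" unfolding closure_sequential by (intro exI[of _ "\<lambda>n. f n + g n"]) simp
next
  fix c :: complex and x assume "x \<in> closure V"
  then obtain f where f: "\<And>n. f n \<in> V" "f \<longlonglongrightarrow> x"
    unfolding closure_sequential by blast
  have "\<forall>n. c *\<^sub>C f n \<in> V" using f complex_vector.subspace_scale[OF assms] by blast
  moreover have "(\<lambda>n. c *\<^sub>C f n) \<longlonglongrightarrow> c *\<^sub>C x"
    using f by (intro bounded_bilinear.tendsto[OF bounded_bilinear_scaleC] tendsto_const)
  ultimately show "c *\<^sub>C x \<in> closure V" unfolding closure_sequential by (intro exI[of _ "\<lambda>n. c *\<^sub>C f n"]) simp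
qed

lemma orth_closure: "orth (closure S) = orth S"
proof (intro subset_antisym subsetI)
  fix x assume x: "x \<in> orth S"
  have "S \<subseteq> {y. cinner x y = 0}" using x by (auto simp: orth_def)
  moreover have "closed {y. cinner x y = 0}"
    by (intro closed_Collect_eq continuous_on_cinner continuous_intros)
  ultimately have "closure S \<subseteq> {y. cinner x y = 0}" by (rule closure_minimal)
  then show "x \<in> orth (closure S)" by (auto simp: orth_def)
next
  fix x assume "x \<in> orth (closure S)"
  then show "x \<in> orth S" using closure_subset by (auto simp: orth_def)
qed

lemma orth_cspan: "orth (cspan S) = orth S"
proof (intro subset_antisym subsetI)
  fix x assume x: "x \<in> orth S"
  have "csubspace {y. cinner x y = 0}"
    by (rule complex_vector.subspaceI) (auto simp: cinner_simps)
  moreover have "S \<subseteq> {y. cinner x y = 0}" using x by (auto simp: orth_def)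
  ultimately have "cspan S \<subseteq> {y. cinner x y = 0}" by (rule complex_vector.span_minimal[rotated])
  then show "x \<in> orth (cspan S)" by (auto simp: orth_def)
next
  fix x assume "x \<in> orth (cspan S)"
  then show "x \<in> orth S" by (auto simp: orth_def complex_vector.span_base)
qed

lemma parallelogram:
  "(norm (u - v))\<^sup>2 = 2 * (norm (u::'a::complex_inner))\<^sup>2 + 2 * (norm v)\<^sup>2 - 4 * (norm ((1/2) *\<^sub>R (u + v)))\<^sup>2"
  by (simp add: norm_add_square[of u] norm_diff_square power_divide) (simp add: field_simps)

text \<open>Near minimizers lie close together: their midpoint is in M, so by the parallelogram
  identity their distance is controlled by their excess over the infimum d.\<close>

lemma nearest_point_exists:
  assumes M: "csubspace (M :: 'a::complex_hilbert set)" "closed M"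
  obtains p where "p \<in> M" "\<And>q. q \<in> M \<Longrightarrow> (norm (x - p))\<^sup>2 \<le> (norm (x - q))\<^sup>2"
proof -
  define d where "d = (INF p\<in>M. (norm (x - p))\<^sup>2)"
  have bdd: "bdd_below ((\<lambda>p. (norm (x - p))\<^sup>2) ` M)" by (rule bdd_belowI2[of _ 0]) simp
  have M0: "0 \<in> M" using M(1) by (rule complex_vector.subspace_0)
  have dle: "d \<le> (norm (x - q))\<^sup>2" if "q \<in> M" for q
    unfolding d_def using bdd that by (rule cINF_lower)
  have "\<exists>p\<in>M. (norm (x - p))\<^sup>2 < d + 1 / real (Suc n)" for n
  proof -
    have "Inf ((\<lambda>p. (norm (x - p))\<^sup>2) ` M) < d + 1 / real (Suc n)" unfolding d_def by simp
    then show ?thesis using cInf_lessD[of "(\<lambda>p. (norm (x - p))\<^sup>2) ` M"] M0 by blast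
  qed
  then obtain p where p: "\<And>n. p n \<in> M" "\<And>n. (norm (x - p n))\<^sup>2 < d + 1 / real (Suc n)" by metis
  have diff: "(norm (p m - p n))\<^sup>2 < 2 / real (Suc m) + 2 / real (Suc n)" for m n
  proof -
    have "(norm (p m - p n))\<^sup>2 = (norm ((x - p n) - (x - p m)))\<^sup>2" by simp
    also have "\<dots> = 2 * (norm (x - p n))\<^sup>2 + 2 * (norm (x - p m))\<^sup>2 - 4 * (norm ((1/2) *\<^sub>R ((x - p n) + (x - p m))))\<^sup>2"
      by (rule parallelogram)
    also have "(1/2) *\<^sub>R ((x - p n) + (x - p m)) = x - complex_of_real (1/2) *\<^sub>C (p n + p m)"
      unfolding scaleC_of_real by (simp add: algebra_simps) (simp add: scaleR_add_left[symmetric])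
    finally have "(norm (p m - p n))\<^sup>2 = 2 * (norm (x - p n))\<^sup>2 + 2 * (norm (x - p m))\<^sup>2
      - 4 * (norm (x - complex_of_real (1/2) *\<^sub>C (p n + p m)))\<^sup>2" .
    moreover have "d \<le> (norm (x - complex_of_real (1/2) *\<^sub>C (p n + p m)))\<^sup>2"
      by (intro dle complex_vector.subspace_scale complex_vector.subspace_add M p)
    moreover have "2 / real (Suc k) = 2 * (1 / real (Suc k))" for k by simp
    ultimately show ?thesis using p(2)[of m] p(2)[of n] by linarith
  qed
  have "Cauchy p"
  proof (rule metric_CauchyI)
    fix e :: real assume "0 < e"
    then obtain N where N: "4 / e\<^sup>2 < real N" using reals_Archimedean2 by blast
    have "dist (p m) (p n) < e" if "N \<le> m" "N \<le> n" for m n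
    proof -
      have Npos: "0 < real N" using N \<open>0 < e\<close> by (smt (verit) divide_pos_pos zero_less_power)
      have a: "2 / real (Suc k) \<le> 2 / real N" if "N \<le> k" for k
        using that Npos by (intro divide_left_mono) auto
      have "(norm (p m - p n))\<^sup>2 < 4 / real N" using diff[of m n] a[OF that(1)] a[OF that(2)] by simp
      also have "\<dots> < e\<^sup>2" using N Npos \<open>0 < e\<close> by (simp add: field_simps)
      finally show ?thesis unfolding dist_norm by (rule power2_less_imp_less) (use \<open>0 < e\<close> in simp)
    qed
    then show "\<exists>N. \<forall>m\<ge>N. \<forall>n\<ge>N. dist (p m) (p n) < e" by blast
  qed
  then obtain l where l: "p \<longlonglongrightarrow> l" using Cauchy_convergent convergent_def by blast
  have lM: "l \<in> M" using M(2) p(1) l by (metis closed_sequentially)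
  have "(norm (x - l))\<^sup>2 \<le> d"
  proof (rule LIMSEQ_le)
    show "(\<lambda>n. (norm (x - p n))\<^sup>2) \<longlonglongrightarrow> (norm (x - l))\<^sup>2" by (intro tendsto_intros l)
    have "(\<lambda>n. 1 / real (Suc n)) \<longlonglongrightarrow> 0" by (rule LIMSEQ_Suc[OF lim_1_over_n])
    from tendsto_add[OF tendsto_const[of d] this] show "(\<lambda>n. d + 1 / real (Suc n)) \<longlonglongrightarrow> d" by simp
    show "\<exists>N. \<forall>n\<ge>N. (norm (x - p n))\<^sup>2 \<le> d + 1 / real (Suc n)" using p(2) less_imp_le by blast
  qed
  then show ?thesis using that[OF lM] dle order_trans by blast
qed

lemma projection_exists:
  assumes M: "csubspace (M :: 'a::complex_hilbert set)" "closed M"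
  shows "\<exists>p\<in>M. x - p \<in> orth M"
proof -
  obtain p where p: "p \<in> M" "\<And>q. q \<in> M \<Longrightarrow> (norm (x - p))\<^sup>2 \<le> (norm (x - q))\<^sup>2"
    using nearest_point_exists[OF M] by blast
  have "cinner (x - p) y = 0" if y: "y \<in> M" for y
  proof -
    define w where "w = cinner (x - p) y"
    have *: "2 * t * (cmod w)\<^sup>2 \<le> t\<^sup>2 * (cmod w)\<^sup>2 * (norm y)\<^sup>2" for t :: real
    proof -
      define c where "c = of_real t * w"
      have "p + c *\<^sub>C y \<in> M"
        by (intro complex_vector.subspace_add complex_vector.subspace_scale M p y)
      then have "(norm (x - p))\<^sup>2 \<le> (norm ((x - p) - c *\<^sub>C y))\<^sup>2"
        using p(2) by (simp add: diff_diff_eq)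
      also have "\<dots> = (norm (x - p))\<^sup>2 - 2 * Re (cnj c * w) + (cmod c * norm y)\<^sup>2"
        by (simp add: norm_diff_square norm_scaleC cinner_scaleC_right w_def)
      also have "Re (cnj c * w) = t * (cmod w)\<^sup>2"
        unfolding c_def cmod_power2 by (simp add: power2_eq_square algebra_simps)
      also have "(cmod c * norm y)\<^sup>2 = t\<^sup>2 * (cmod w)\<^sup>2 * (norm y)\<^sup>2"
        by (simp add: c_def norm_mult power_mult_distrib)
      finally show ?thesis by simp
    qed
    \<comment> \<open>Any positive t with \<open>t * (norm y)^2 < 2\<close> lets the linear term
      dominate; the summand 1 keeps the denominator nonzero at \<open>y = 0\<close>.\<close>
    define t where "t = 1 / ((norm y)\<^sup>2 + 1)"
    have t: "0 < t" "t * (norm y)\<^sup>2 < 1" by (auto simp: t_def add_pos_nonneg add_nonneg_pos)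
    have "0 \<le> t * (cmod w)\<^sup>2 * (t * (norm y)\<^sup>2 - 2)"
      using *[of t] by (simp add: power2_eq_square algebra_simps)
    moreover have "t * (norm y)\<^sup>2 - 2 < 0" using t(2) by simp
    ultimately have "t * (cmod w)\<^sup>2 \<le> 0" by (simp add: zero_le_mult_iff)
    then have "(cmod w)\<^sup>2 \<le> 0" using t(1) by (simp add: mult_le_0_iff)
    then show ?thesis by (simp add: w_def)
  qed
  then show ?thesis using p(1) by (auto intro: orthI)
qed

definition proj :: "'a::complex_hilbert set \<Rightarrow> 'a \<Rightarrow> 'a"
  where "proj M x = (SOME p. p \<in> M \<and> x - p \<in> orth M)"

context
  fixes M :: "'a::complex_hilbert set"
  assumes M: "csubspace M" "closed M"
begin

lemma proj_mem: "proj M x \<in> M"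
  and proj_orth: "x - proj M x \<in> orth M"
proof -
  have "\<exists>p. p \<in> M \<and> x - p \<in> orth M" using projection_exists[OF M] by blast
  from someI_ex[OF this] show "proj M x \<in> M" "x - proj M x \<in> orth M"
    unfolding proj_def by auto
qed

lemma proj_unique:
  assumes "p \<in> M" "x - p \<in> orth M"
  shows "proj M x = p"
proof -
  have "proj M x - p \<in> M" using proj_mem assms(1) M(1) complex_vector.subspace_diff by blast
  moreover have "(x - p) - (x - proj M x) \<in> orth M"
    by (rule complex_vector.subspace_diff[OF csubspace_orth assms(2) proj_orth])
  then have "proj M x - p \<in> orth M" by simp
  ultimately show ?thesis using orth_Int_self by fastforce
qed

lemma proj_eq_self: "x \<in> M \<Longrightarrow> proj M x = x"
  by (rule proj_unique) (simp_all add: complex_vector.subspace_0[OF csubspace_orth])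

lemma proj_eq_zero: "x \<in> orth M \<Longrightarrow> proj M x = 0"
  by (rule proj_unique) (simp_all add: complex_vector.subspace_0[OF M(1)])

lemma orth_orth: "orth (orth M) = M"
proof (intro subset_antisym subsetI)
  fix x assume x: "x \<in> orth (orth M)"
  have "proj M x \<in> orth (orth M)" using proj_mem orthD' by (blast intro: orthI)
  then have "x - proj M x \<in> orth (orth M)" using x csubspace_orth complex_vector.subspace_diff by blast
  then have "x - proj M x = 0" using orth_Int_self proj_orth by blast
  then show "x \<in> M" using proj_mem[of x] by simp
next
  fix x assume "x \<in> M"
  then show "x \<in> orth (orth M)" using orthD' by (blast intro: orthI)
qed

lemma clinear_op_proj: "clinear_op (proj M)"
proof (rule clinear_opI)
  fix x y
  have "(x - proj M x) + (y - proj M y) \<in> orth M"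
    by (intro complex_vector.subspace_add csubspace_orth proj_orth)
  then have "(x + y) - (proj M x + proj M y) \<in> orth M" by (simp add: algebra_simps)
  then show "proj M (x + y) = proj M x + proj M y"
    by (intro proj_unique complex_vector.subspace_add M proj_mem)
next
  fix c x
  have "c *\<^sub>C (x - proj M x) \<in> orth M"
    by (intro complex_vector.subspace_scale csubspace_orth proj_orth)
  then show "proj M (c *\<^sub>C x) = c *\<^sub>C proj M x"
    by (intro proj_unique complex_vector.subspace_scale M proj_mem)
       (simp add: complex_vector.scale_right_diff_distrib)
qed

lemma norm_proj_square: "(norm x)\<^sup>2 = (norm (proj M x))\<^sup>2 + (norm (x - proj M x))\<^sup>2"
  using pythagoras[of "proj M x" "x - proj M x"] orthD'[OF proj_orth proj_mem] by simp

lemma norm_proj_le: "norm (proj M x) \<le> norm x"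
  and norm_diff_proj_le: "norm (x - proj M x) \<le> norm x"
  using norm_proj_square[of x] by (auto intro: power2_le_imp_le)

end

section \<open>Compactness and dimension of finitely spanned subspaces\<close>

lemma closed_if_compact_Int_cball:
  fixes V :: "'a::real_normed_vector set"
  assumes "\<And>r. compact (V \<inter> cball 0 r)"
  shows "closed V"
  unfolding closed_sequential_limits
proof (intro allI impI, elim conjE)
  fix u l assume u: "\<forall>n. u n \<in> V" and l: "u \<longlonglongrightarrow> l"
  then have "Bseq u" using convergentI convergent_imp_Bseq by blast
  then obtain r where "\<And>n. norm (u n) \<le> r" by (auto simp: Bseq_def)
  then have "\<And>n. u n \<in> V \<inter> cball 0 r" using u by auto
  then have "l \<in> V \<inter> cball 0 r"
    using closed_sequentially[OF compact_imp_closed[OF assms]] l by blast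
  then show "l \<in> V" by simp
qed

text \<open>Only the component e of the new vector orthogonal to the old span V matters. By
  Pythagoras both coordinates of a vector in the ball are bounded, so the ball lies in a continuous
  image of a ball of V times a disc. The radius is generalized because closedness of V, needed for
  the projection, uses compactness at every radius.\<close>

lemma compact_cspan_Int_cball:
  fixes B :: "'a::complex_hilbert set"
  assumes "finite B"
  shows "compact (cspan B \<inter> cball 0 r)"
  using assms
proof (induction B arbitrary: r)
  case empty
  have "cspan {} \<inter> cball 0 r \<subseteq> {0 :: 'a}" by (simp add: complex_vector.span_empty)
  then show ?case by (meson finite.emptyI finite.insertI finite_imp_compact finite_subset)
next
  case (insert b B)
  define V where "V = cspan B"
  have V: "csubspace V" "closed V"
    unfolding V_def using closed_if_compact_Int_cball[OF insert.IH] by simp_all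
  define e where "e = b - proj V b"
  have eV: "e \<in> orth V" unfolding e_def by (rule proj_orth[OF V])
  show ?case
  proof (cases "e = 0")
    case True
    then have "b \<in> cspan B" using proj_mem[OF V, of b] by (simp add: e_def V_def)
    then have "cspan (insert b B) = cspan B" by (rule complex_vector.span_redundant)
    then show ?thesis using insert.IH by simp
  next
    case False
    define I where "I = (\<lambda>(y, c). y + c *\<^sub>C e) ` ((V \<inter> cball 0 r) \<times> cball 0 (r / norm e))"
    have bW: "b \<in> cspan (insert b B)" and VW: "V \<subseteq> cspan (insert b B)"
      unfolding V_def by (auto intro: complex_vector.span_base complex_vector.span_mono[THEN subsetD])
    have eW: "e \<in> cspan (insert b B)"
      unfolding e_def by (rule complex_vector.span_diff[OF bW]) (rule subsetD[OF VW proj_mem[OF V]])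
    have "cspan (insert b B) \<inter> cball 0 r \<subseteq> I"
    proof
      fix x assume x: "x \<in> cspan (insert b B) \<inter> cball 0 r"
      then obtain c where c: "x - c *\<^sub>C b \<in> V"
        unfolding V_def complex_vector.span_insert by blast
      define y where "y = (x - c *\<^sub>C b) + c *\<^sub>C proj V b"
      have y: "y \<in> V" unfolding y_def
        by (intro complex_vector.subspace_add complex_vector.subspace_scale V c proj_mem[OF V])
      have xe: "x = y + c *\<^sub>C e" by (simp add: y_def e_def complex_vector.scale_right_diff_distrib)
      have "cinner y (c *\<^sub>C e) = 0" using orthD'[OF eV y] by (simp add: cinner_simps)
      then have "(norm x)\<^sup>2 = (norm y)\<^sup>2 + (norm (c *\<^sub>C e))\<^sup>2" unfolding xe by (rule pythagoras)
      then have "norm y \<le> norm x" "norm (c *\<^sub>C e) \<le> norm x" by (auto intro: power2_le_imp_le)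
      then have "norm y \<le> r" "cmod c \<le> r / norm e"
        using x False by (auto simp: norm_scaleC field_simps)
      then show "x \<in> I" unfolding I_def xe using y by force
    qed
    moreover have "I \<subseteq> cspan (insert b B)"
    proof (unfold I_def, clarify)
      fix y c assume "y \<in> V"
      then show "y + c *\<^sub>C e \<in> cspan (insert b B)"
        using VW by (intro complex_vector.span_add complex_vector.span_scale eW) blast
    qed
    ultimately have eq: "cspan (insert b B) \<inter> cball 0 r = I \<inter> cball 0 r" by blast
    have "compact I" unfolding I_def
      by (intro compact_continuous_image compact_Times insert.IH[folded V_def] compact_cball)
         (auto simp: split_beta intro!: continuous_intros bounded_bilinear.continuous_on[OF bounded_bilinear_scaleC])
    then show ?thesis unfolding eq by (rule compact_Int_closed) simp
  qed
qed

lemma closed_cspan_finite: "finite B \<Longrightarrow> closed (cspan (B :: 'a::complex_hilbert set))"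
  by (rule closed_if_compact_Int_cball) (rule compact_cspan_Int_cball)

text \<open>Injectivity carries a basis of M to an independent subset of V, whose size a finite
  spanning set bounds. It serves for subspaces that meet the kernel of a finite rank operator
  trivially.\<close>

lemma cfinite_dim_if_injective_image:
  assumes lin: "clinear_op A" and M: "csubspace M" and inj: "\<And>x. x \<in> M \<Longrightarrow> A x = 0 \<Longrightarrow> x = 0"
    and fin: "cfinite_dim V" and sub: "A ` M \<subseteq> V"
  shows "cfinite_dim M"
proof -
  interpret L: Vector_Spaces.linear "(*\<^sub>C)" "(*\<^sub>C)" A using lin by (simp add: clinear_op_def)
  obtain B where B: "B \<subseteq> M" "complex_vector.independent B" "M \<subseteq> cspan B"
    by (rule complex_vector.basis_exists[of M])
  have span: "cspan B = M"
    using complex_vector.span_minimal[OF B(1) M] B(3) by (rule equalityI)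
  have injB: "inj_on A (cspan B)"
    unfolding span
  proof (rule inj_onI)
    fix x y assume "x \<in> M" "y \<in> M" "A x = A y"
    then have "x - y \<in> M" "A (x - y) = 0"
      by (simp_all only: complex_vector.subspace_diff[OF M] clinear_op_diff[OF lin]) simp
    then show "x = y" using inj[of "x - y"] by simp
  qed
  have "complex_vector.independent (A ` B)"
    using B(2) injB unfolding cspan_def by (rule L.independent_injective_image)
  moreover obtain C where C: "finite C" "V = cspan C" using fin by (auto simp: cfinite_dim_def)
  moreover have "A ` B \<subseteq> cspan C" using B(1) sub C by blast
  ultimately have "finite (A ` B)"
    using complex_vector.independent_span_bound[of C "A ` B"] by blast
  moreover have "inj_on A B" using injB complex_vector.span_superset by (rule inj_on_subset)
  ultimately have "finite B" by (rule finite_imageD)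
  then show ?thesis using span by (auto simp: cfinite_dim_def)
qed

lemma cfinite_dim_image:
  assumes lin: "clinear_op A" and "cfinite_dim V"
  shows "cfinite_dim (A ` V)"
proof -
  interpret L: Vector_Spaces.linear "(*\<^sub>C)" "(*\<^sub>C)" A using lin by (simp add: clinear_op_def)
  obtain B where "finite B" "V = cspan B" using assms by (auto simp: cfinite_dim_def)
  then have "finite (A ` B) \<and> A ` V = cspan (A ` B)" using L.span_image[of B] by (simp add: cspan_def)
  then show ?thesis unfolding cfinite_dim_def by blast
qed


section \<open>Positive square roots and positive parts\<close>

lemma bounded_ops_clinear: "T \<in> bounded_ops \<Longrightarrow> clinear_op T"
  by (rule clinear_opI) (auto simp: bounded_ops_def linear_simps)

lemma bounded_ops_bounded_linear: "T \<in> bounded_ops \<Longrightarrow> bounded_linear T"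
  by (simp add: bounded_ops_def)

lemma bounded_opsI:
  assumes "clinear_op T" "\<And>x. norm (T x) \<le> c * norm x"
  shows "T \<in> bounded_ops"
proof -
  have "bounded_linear T"
    using clinear_op_add[OF assms(1)] clinear_op_scaleR[OF assms(1)] assms(2)
    by (intro bounded_linear_intro[of _ c]) (auto simp: mult.commute)
  then show ?thesis using clinear_op_scaleC[OF assms(1)] by (auto simp: bounded_ops_def)
qed

lemma bounded_opsE:
  assumes "T \<in> bounded_ops"
  obtains c where "0 < c" "\<And>x. norm (T x) \<le> c * norm x"
  using bounded_linear.pos_bounded[OF bounded_ops_bounded_linear[OF assms]] by (metis mult.commute)

lemma hadjoint_symmetric:
  assumes "T \<in> bounded_ops" "symmetric_op T"
  shows "hadjoint T = T"
  unfolding hadjoint_def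
proof (rule the_equality)
  show "T \<in> bounded_ops \<and> (\<forall>x y. cinner (T x) y = cinner x (T y))"
    using assms by (simp add: symmetric_op_def)
next
  fix S assume S: "S \<in> bounded_ops \<and> (\<forall>x y. cinner (T x) y = cinner x (S y))"
  show "S = T"
  proof
    fix y
    have "cinner (S y - T y) (S y - T y) = 0"
      using S symmetric_opD[OF assms(2), of "S y - T y" y] by (simp add: cinner_diff_right)
    then have "S y - T y = 0" by (simp only: cinner_self_eq_zero)
    then show "S y = T y" by simp
  qed
qed

text \<open>Over the complex numbers positivity of the quadratic form forces symmetry by polarization,
  so the existence of adjoints is never needed.\<close>

lemma positive_op_iff:
  "positive_op T \<longleftrightarrow> T \<in> bounded_ops \<and> symmetric_op T \<and> (\<forall>x. 0 \<le> Re (cinner (T x) x))"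
proof
  assume T: "positive_op T"
  then have b: "T \<in> bounded_ops" by (simp add: positive_op_def self_adjoint_def)
  moreover have "symmetric_op T"
    using T by (intro symmetric_opI_real bounded_ops_clinear[OF b])
       (simp add: positive_op_def complex_is_Real_iff complex_nonneg_Reals_iff)
  ultimately show "T \<in> bounded_ops \<and> symmetric_op T \<and> (\<forall>x. 0 \<le> Re (cinner (T x) x))"
    using T by (simp add: positive_op_def complex_nonneg_Reals_iff)
next
  assume T: "T \<in> bounded_ops \<and> symmetric_op T \<and> (\<forall>x. 0 \<le> Re (cinner (T x) x))"
  then have "Im (cinner (T x) x) = 0" for x
    using arg_cong[OF cinner_symmetric_op_self[of T x], of Im] by simp
  then show "positive_op T"
    using T by (simp add: positive_op_def complex_nonneg_Reals_iff self_adjoint_def hadjoint_symmetric)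
qed

lemma positive_opI:
  "T \<in> bounded_ops \<Longrightarrow> symmetric_op T \<Longrightarrow> (\<And>x. 0 \<le> Re (cinner (T x) x)) \<Longrightarrow> positive_op T"
  by (simp add: positive_op_iff)

section \<open>Comparison of two positive square roots\<close>

lemma symmetric_op_diff:
  "symmetric_op A \<Longrightarrow> symmetric_op B \<Longrightarrow> symmetric_op (\<lambda>x. A x - B x)"
  by (simp add: symmetric_op_def cinner_simps)

lemma clinear_op_diff_op:
  "clinear_op A \<Longrightarrow> clinear_op B \<Longrightarrow> clinear_op (\<lambda>x. A x - B x)"
  by (rule clinear_opI) (simp_all add: clinear_op_simps complex_vector.scale_right_diff_distrib)

lemma form_le:
  assumes "norm (T x) \<le> c * norm x"
  shows "Re (cinner (T x) x) \<le> c * (norm (x::'a::complex_inner))\<^sup>2"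
  using Re_cinner_le[of "T x" x] mult_right_mono[OF assms norm_ge_zero[of x]]
  by (simp add: power2_eq_square)

text \<open>Expanding the left side gives \<open>d^4 - 2 d^2 |D x|^2 + |D (D x)|^2\<close>, whose
  last term is at most \<open>d^4\<close>. So vectors at which D almost attains d are almost
  eigenvectors of \<open>D^2\<close>.\<close>

lemma square_defect_le:
  assumes sym: "symmetric_op D" and D: "\<And>x. norm (D x) \<le> d * norm x" and d: "0 \<le> d" and x: "norm x = 1"
  shows "(norm (d\<^sup>2 *\<^sub>R x - D (D x)))\<^sup>2 \<le> 2 * d\<^sup>2 * (d\<^sup>2 - (norm (D x))\<^sup>2)"
proof -
  have "norm (D (D x)) \<le> d * d"
    using D[of "D x"] mult_left_mono[OF D[of x] d] x by simp
  then have "(norm (D (D x)))\<^sup>2 \<le> d\<^sup>2 * d\<^sup>2"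
    using power_mono[of "norm (D (D x))" "d * d" 2] by (simp add: power_mult_distrib)
  moreover have "Re (cinner x (D (D x))) = (norm (D x))\<^sup>2"
    by (simp add: symmetric_opD[OF sym, symmetric] cinner_self del: of_real_power)
  ultimately show ?thesis
    using x by (simp add: norm_diff_square cinner_simps power_mult_distrib power2_eq_square[of d] algebra_simps)
qed

text \<open>With \<open>D = R - R'\<close>, equality of the squares gives
  \<open>D R + R' D = 0\<close>. Hence \<open>R' D^2 = - D R D\<close>, whose form is nonpositive,
  and the form of \<open>d^2 R'\<close> is at most that of \<open>R' (d^2 - D^2)\<close>. Then
  \<open>psd_norm_le\<close> passes from the form of \<open>R'\<close> to its norm. Exchanging the
  roots leaves \<open>D^2\<close> unchanged, so the same bound is available for R.\<close>

lemma sqrt_difference_bound: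
  assumes R: "positive_op R" and R': "positive_op R'" and sq: "R \<circ> R = R' \<circ> R'"
    and D: "\<And>x. norm (R x - R' x) \<le> d * norm x" and c: "\<And>x. norm (R' x) \<le> c * norm x" "0 \<le> c"
    and x: "norm x = 1"
  shows "d\<^sup>2 * (norm (R' x))\<^sup>2 \<le> c\<^sup>2 * norm (d\<^sup>2 *\<^sub>R x - (R (R x - R' x) - R' (R x - R' x)))"
proof -
  define D where "D = (\<lambda>x. R x - R' x)"
  have lin: "clinear_op R" "clinear_op R'" and sym: "symmetric_op R" "symmetric_op R'"
    using R R' by (auto simp: positive_op_iff bounded_ops_clinear)
  have symD: "symmetric_op D" unfolding D_def using sym by (rule symmetric_op_diff)
  have "R (R y) = R' (R' y)" for y using fun_cong[OF sq] by simp
  then have "D (R y) + R' (D y) = 0" for y by (simp add: D_def clinear_op_simps[OF lin(2)])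
  then have "R' (D y) = - D (R y)" for y by (simp add: eq_neg_iff_add_eq_0 add.commute)
  then have "cinner (R' (D (D x))) x = - cinner (R (D x)) (D x)"
    using symmetric_opD[OF symD] by (simp add: cinner_simps)
  moreover have "0 \<le> Re (cinner (R (D x)) (D x))" using R by (simp add: positive_op_iff)
  ultimately have "Re (cinner (R' (D (D x))) x) \<le> 0" by simp
  then have "d\<^sup>2 * Re (cinner (R' x) x) \<le> Re (cinner (R' (d\<^sup>2 *\<^sub>R x - D (D x))) x)"
    by (simp add: clinear_op_simps[OF lin(2)] cinner_simps)
  also have "\<dots> \<le> c * norm (d\<^sup>2 *\<^sub>R x - D (D x))"
    using Re_cinner_le[of "R' (d\<^sup>2 *\<^sub>R x - D (D x))" x] c(1)[of "d\<^sup>2 *\<^sub>R x - D (D x)"] x by simp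
  finally have 1: "d\<^sup>2 * Re (cinner (R' x) x) \<le> c * norm (d\<^sup>2 *\<^sub>R x - D (D x))" .
  have "(norm (R' x))\<^sup>2 \<le> c * Re (cinner (R' x) x)"
    by (rule psd_norm_le(1)[OF lin(2) sym(2), of UNIV])
       (use R' form_le[of R', OF c(1)] in \<open>auto simp: positive_op_iff\<close>)
  then have "d\<^sup>2 * (norm (R' x))\<^sup>2 \<le> d\<^sup>2 * (c * Re (cinner (R' x) x))" by (rule mult_left_mono) simp
  also have "\<dots> = c * (d\<^sup>2 * Re (cinner (R' x) x))" by (simp add: mult_ac)
  also have "\<dots> \<le> c * (c * norm (d\<^sup>2 *\<^sub>R x - D (D x)))" using 1 c(2) by (rule mult_left_mono)
  finally show ?thesis by (simp add: D_def power2_eq_square mult_ac)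
qed

text \<open>At vectors where the difference of two roots almost attains its norm \<open>d\<close>, the identity
  \<open>D R D + R' D\<^sup>2 = 0\<close> makes both roots small, which is only possible for \<open>d = 0\<close>.
  No commutation of the roots is involved.\<close>

lemma positive_sqrt_unique:
  assumes R: "positive_op R" and R': "positive_op R'" and sq: "R \<circ> R = R' \<circ> R'"
  shows "R = R'"
proof -
  define D where "D = (\<lambda>x. R x - R' x)"
  have b: "R \<in> bounded_ops" "R' \<in> bounded_ops" using R R' by (auto simp: positive_op_iff)
  have symD: "symmetric_op D" unfolding D_def using R R' by (intro symmetric_op_diff) (auto simp: positive_op_iff)
  have linD: "clinear_op D" unfolding D_def using b by (intro clinear_op_diff_op bounded_ops_clinear)
  obtain a where a: "0 < a" "\<And>x. norm (R x) \<le> a * norm x" using bounded_opsE[OF b(1)] by blast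
  obtain a' where a': "0 < a'" "\<And>x. norm (R' x) \<le> a' * norm x" using bounded_opsE[OF b(2)] by blast
  define c where "c = a + a'"
  have c: "0 < c" "\<And>x. norm (R x) \<le> c * norm x" "\<And>x. norm (R' x) \<le> c * norm x"
    using a a' order_trans[OF a(2) mult_right_mono[of a c]] order_trans[OF a'(2) mult_right_mono[of a' c]]
    by (auto simp: c_def)
  have blD: "bounded_linear D" unfolding D_def
    using b by (intro bounded_linear_sub bounded_ops_bounded_linear)
  define d where "d = onorm D"
  have Dd: "norm (D x) \<le> d * norm x" for x unfolding d_def by (rule onorm[OF blD])
  have d0: "0 \<le> d" unfolding d_def by (rule onorm_pos_le[OF blD])
  have "d = 0"
  proof (rule ccontr)
    assume "d \<noteq> 0"
    then have d: "0 < d" using d0 by simp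
    \<comment> \<open>Obtained from \<open>d^4 |D x|^4 \<le> 16 c^4 n^2\<close> and
      \<open>n^2 \<le> 2 d^2 (d^2 - |D x|^2)\<close> on dividing by \<open>d^4\<close>.\<close>
    define C where "C = 32 * c ^ 4 / d\<^sup>2"
    have C: "0 < C" using c d by (simp add: C_def)
    have key: "((norm (D x))\<^sup>2)\<^sup>2 \<le> C * (d\<^sup>2 - (norm (D x))\<^sup>2)" if x: "norm x = 1" for x
    proof -
      define n where "n = norm (d\<^sup>2 *\<^sub>R x - D (D x))"
      have 1: "d\<^sup>2 * (norm (R' x))\<^sup>2 \<le> c\<^sup>2 * n"
        unfolding n_def D_def
        by (rule sqrt_difference_bound[OF R R' sq Dd[unfolded D_def] c(3) _ x]) (use c in simp)
      have D': "norm (R' x - R x) \<le> d * norm x" for x using Dd[of x] by (simp add: D_def norm_minus_commute)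
      have "R' (R' x - R x) - R (R' x - R x) = D (D x)"
        by (simp add: D_def clinear_op_simps[OF bounded_ops_clinear[OF b(1)]] clinear_op_simps[OF bounded_ops_clinear[OF b(2)]])
      then have 2: "d\<^sup>2 * (norm (R x))\<^sup>2 \<le> c\<^sup>2 * n"
        using sqrt_difference_bound[OF R' R sq[symmetric] D' c(2) _ x] c by (simp add: n_def)
      have "(norm (D x))\<^sup>2 \<le> (norm (R x) + norm (R' x))\<^sup>2"
        by (rule power_mono) (auto simp: D_def norm_triangle_ineq4)
      also have "\<dots> \<le> 2 * (norm (R x))\<^sup>2 + 2 * (norm (R' x))\<^sup>2"
        using zero_le_power2[of "norm (R x) - norm (R' x)"] by (simp add: power2_eq_square algebra_simps)
      finally have "d\<^sup>2 * (norm (D x))\<^sup>2 \<le> d\<^sup>2 * (2 * (norm (R x))\<^sup>2 + 2 * (norm (R' x))\<^sup>2)"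
        by (rule mult_left_mono) simp
      also have "\<dots> \<le> 4 * c\<^sup>2 * n" using 1 2 by (simp add: algebra_simps)
      finally have "(d\<^sup>2 * (norm (D x))\<^sup>2)\<^sup>2 \<le> (4 * c\<^sup>2 * n)\<^sup>2" by (rule power_mono) simp
      also have "\<dots> = 16 * c ^ 4 * n\<^sup>2" by (simp add: power_mult_distrib flip: power_mult)
      also have "\<dots> \<le> 16 * c ^ 4 * (2 * d\<^sup>2 * (d\<^sup>2 - (norm (D x))\<^sup>2))"
        unfolding n_def by (intro mult_left_mono square_defect_le[OF symD Dd d0 x]) simp
      finally have "d\<^sup>2 * (d\<^sup>2 * ((norm (D x))\<^sup>2)\<^sup>2) \<le> d\<^sup>2 * (32 * c ^ 4 * (d\<^sup>2 - (norm (D x))\<^sup>2))"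
        by (simp add: power_mult_distrib power2_eq_square algebra_simps)
      then have "d\<^sup>2 * ((norm (D x))\<^sup>2)\<^sup>2 \<le> 32 * c ^ 4 * (d\<^sup>2 - (norm (D x))\<^sup>2)"
        using d by (simp only: mult_le_cancel_left_pos zero_less_power)
      moreover have "C * (d\<^sup>2 - (norm (D x))\<^sup>2) = 32 * c ^ 4 * (d\<^sup>2 - (norm (D x))\<^sup>2) / d\<^sup>2"
        by (simp add: C_def)
      ultimately show ?thesis using d by (simp only: pos_le_divide_eq zero_less_power mult.commute)
    qed
    \<comment> \<open>A uniform gap below \<open>d^2\<close>: either \<open>|D x|^2\<close> is at
      most \<open>d^2 / 2\<close>, or its square is at least \<open>d^4 / 4\<close> and
      \<open>key\<close> forces a deficit of at least \<open>d^4 / (4 * C)\<close>. This contradicts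
      that d is the operator norm.\<close>
    define k where "k = max (d\<^sup>2 / 2) (d\<^sup>2 - d ^ 4 / (4 * C))"
    have k: "0 \<le> k" "k < d\<^sup>2" using d C by (auto simp: k_def le_max_iff_disj)
    have unit: "(norm (D x))\<^sup>2 \<le> k" if "norm x = 1" for x
    proof (cases "(norm (D x))\<^sup>2 \<le> d\<^sup>2 / 2")
      case False
      then have "(d\<^sup>2 / 2)\<^sup>2 \<le> ((norm (D x))\<^sup>2)\<^sup>2" by (intro power_mono) auto
      also note key[OF that]
      finally have "(norm (D x))\<^sup>2 \<le> d\<^sup>2 - d ^ 4 / (4 * C)"
        using C by (simp add: field_simps power_divide flip: power_mult)
      then show ?thesis by (simp add: k_def)
    qed (simp add: k_def)
    have "norm (D x) \<le> sqrt k * norm x" for x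
    proof (cases "x = 0")
      case False
      have "(norm (D ((1 / norm x) *\<^sub>R x)))\<^sup>2 \<le> k" using False by (intro unit) simp
      then have "norm (D ((1 / norm x) *\<^sub>R x)) \<le> sqrt k" by (rule real_le_rsqrt)
      then show ?thesis using False by (simp add: clinear_op_scaleR[OF linD] field_simps)
    qed (simp add: clinear_op_zero[OF linD])
    then have "d \<le> sqrt k" unfolding d_def using k by (intro onorm_bound) auto
    then have "d\<^sup>2 \<le> k" using d0 k(1) by (metis power_mono real_sqrt_pow2)
    then show False using k by simp
  qed
  then have "D x = 0" for x using Dd[of x] by simp
  then show ?thesis by (auto simp: D_def fun_eq_iff)
qed

section \<open>Absolute value, positive part and negative part\<close>

lemma abs_op_eqI:
  assumes S: "S \<in> bounded_ops" "symmetric_op S" and R: "positive_op R" "R \<circ> R = S \<circ> S"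
  shows "abs_op S = R"
  unfolding abs_op_def sqrt_op_def hadjoint_symmetric[OF S]
  using R by (intro the_equality) (auto intro: positive_sqrt_unique)

text \<open>The cross terms vanish, so \<open>K + F\<close> is positive with square
  \<open>S^2\<close>, hence equals \<open>|S|\<close>; adding or subtracting S and halving leaves K
  or F.\<close>

lemma pos_neg_part_eqI:
  fixes S K F :: "'a::complex_hilbert \<Rightarrow> 'a"
  assumes K: "positive_op K" and F: "positive_op F" and S: "\<And>x. S x = K x - F x"
    and KF: "\<And>x. K (F x) = 0" "\<And>x. F (K x) = 0"
  shows "pos_part S = K" and "neg_part S = F"
proof -
  have b: "K \<in> bounded_ops" "F \<in> bounded_ops" and sym: "symmetric_op K" "symmetric_op F"
    using K F by (auto simp: positive_op_iff)
  note lin = bounded_ops_clinear[OF b(1)] bounded_ops_clinear[OF b(2)]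
  obtain a where a: "0 < a" "\<And>x. norm (K x) \<le> a * norm x" using bounded_opsE[OF b(1)] by blast
  obtain a' where a': "0 < a'" "\<And>x. norm (F x) \<le> a' * norm x" using bounded_opsE[OF b(2)] by blast
  have S': "S = (\<lambda>x. K x - F x)" using S by auto
  have Sb: "S \<in> bounded_ops" unfolding S'
  proof (rule bounded_opsI)
    show "norm (K x - F x) \<le> (a + a') * norm x" for x
      using norm_triangle_ineq4[of "K x" "F x"] a(2)[of x] a'(2)[of x] by (simp add: algebra_simps)
  qed (intro clinear_op_diff_op lin)
  have Ssym: "symmetric_op S" unfolding S' using sym by (rule symmetric_op_diff)
  have "positive_op (\<lambda>x. K x + F x)"
  proof (rule positive_opI)
    show "(\<lambda>x. K x + F x) \<in> bounded_ops"
    proof (rule bounded_opsI)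
      show "clinear_op (\<lambda>x. K x + F x)"
        by (rule clinear_opI) (simp_all add: clinear_op_simps[OF lin(1)] clinear_op_simps[OF lin(2)] scaleC_add_right)
      show "norm (K x + F x) \<le> (a + a') * norm x" for x
        using norm_triangle_ineq[of "K x" "F x"] a(2)[of x] a'(2)[of x] by (simp add: algebra_simps)
    qed
    show "symmetric_op (\<lambda>x. K x + F x)" using sym by (simp add: symmetric_op_def cinner_simps)
    show "0 \<le> Re (cinner (K x + F x) x)" for x using K F by (simp add: positive_op_iff cinner_simps)
  qed
  moreover have "(\<lambda>x. K x + F x) \<circ> (\<lambda>x. K x + F x) = S \<circ> S"
    by (simp add: S fun_eq_iff clinear_op_simps[OF lin(1)] clinear_op_simps[OF lin(2)] KF)
  ultimately have abs: "abs_op S = (\<lambda>x. K x + F x)" by (rule abs_op_eqI[OF Sb Ssym])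
  have half: "(1/2) *\<^sub>C (y + y) = y" for y :: 'a
    using scaleC_of_real[of "1/2" "y + y"] by (simp flip: scaleR_2)
  have *: "K x + F x + S x = K x + K x" "K x + F x - S x = F x + F x" for x by (simp_all add: S)
  show "pos_part S = K" "neg_part S = F"
    by (simp_all only: pos_part_def neg_part_def abs half *)
qed


section \<open>Compact perturbations attain their norm\<close>

lemma norm_quotient_le:
  assumes "\<And>x. norm (T x) \<le> c * norm (x::'a::real_normed_vector)" "0 \<le> c"
  shows "norm (T x) / norm x \<le> c"
\<comment> \<open>At 0 the quotient is 0 by the convention on division, and c has to dominate that
  value too.\<close>
proof (cases "x = 0")
  case False
  then show ?thesis using assms(1)[of x] by (simp add: field_simps)
qed (simp add: assms)

lemma norm_le_onorm_on:
  assumes T: "T \<in> bounded_ops" and x: "x \<in> M"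
  shows "norm (T x) \<le> onorm_on M T * norm x"
proof -
  obtain c where c: "0 < c" "\<And>x. norm (T x) \<le> c * norm x" using bounded_opsE[OF T] by blast
  have bdd: "bdd_above ((\<lambda>x. norm (T x) / norm x) ` M)"
    using c norm_quotient_le[of T c] by (intro bdd_aboveI2[of _ _ c]) auto
  have "norm (T x) / norm x \<le> onorm_on M T" unfolding onorm_on_def using x bdd by (rule cSUP_upper)
  then show "norm (T x) \<le> onorm_on M T * norm x"
    using clinear_op_zero[OF bounded_ops_clinear[OF T]] by (cases "x = 0") (simp_all add: pos_divide_le_eq)
qed

text \<open>Trades the supremum of quotients for a comparison of vectors, the shape in which
  maximality is used below.\<close>

lemma norm_attaining_on_iff:
  assumes T: "T \<in> bounded_ops"
  shows "norm_attaining_on M T \<longleftrightarrow> (\<exists>x\<in>M. norm x = 1 \<and> (\<forall>y\<in>M. norm (T y) \<le> norm (T x) * norm y))"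
proof
  assume "norm_attaining_on M T"
  then show "\<exists>x\<in>M. norm x = 1 \<and> (\<forall>y\<in>M. norm (T y) \<le> norm (T x) * norm y)"
    using norm_le_onorm_on[OF T] by (auto simp: norm_attaining_on_def)
next
  assume "\<exists>x\<in>M. norm x = 1 \<and> (\<forall>y\<in>M. norm (T y) \<le> norm (T x) * norm y)"
  then obtain x where x: "x \<in> M" "norm x = 1" "\<And>y. y \<in> M \<Longrightarrow> norm (T y) \<le> norm (T x) * norm y" by blast
  have "onorm_on M T = norm (T x)"
    unfolding onorm_on_def
  proof (rule cSup_eq_maximum)
    show "norm (T x) \<in> (\<lambda>x. norm (T x) / norm x) ` M" using x by force
    fix z assume "z \<in> (\<lambda>x. norm (T x) / norm x) ` M"
    then obtain y where y: "y \<in> M" "z = norm (T y) / norm y" by blast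
    show "z \<le> norm (T x)"
      using x(3)[OF y(1)] by (cases "y = 0") (simp_all add: y(2) pos_divide_le_eq)
  qed
  then show "norm_attaining_on M T" using x by (auto simp: norm_attaining_on_def)
qed

lemma csubspace_unit_vector:
  assumes M: "csubspace (M :: 'a::complex_hilbert set)" and x: "x \<in> M" "x \<noteq> 0"
  shows "(1 / norm x) *\<^sub>R x \<in> M" "norm ((1 / norm x) *\<^sub>R x) = 1"
  using complex_vector.subspace_scale[OF M x(1), of "complex_of_real (1 / norm x)", unfolded scaleC_of_real] x(2)
  by simp_all

lemma maximizing_sequence:
  assumes T: "T \<in> bounded_ops" and M: "csubspace M" "M \<noteq> {0}"
  obtains u where "\<And>n. u n \<in> M" "\<And>n. norm (u n) = 1" "(\<lambda>n. norm (T (u n))) \<longlonglongrightarrow> onorm_on M T"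
proof -
  define s where "s = onorm_on M T"
  have M0: "0 \<in> M" using M(1) by (rule complex_vector.subspace_0)
  obtain v where v: "v \<in> M" "v \<noteq> 0" using M M0 by blast
  have "\<exists>x\<in>M. norm x = 1 \<and> s - 1 / real (Suc n) < norm (T x)" for n
  proof -
    have "s - 1 / real (Suc n) < Sup ((\<lambda>x. norm (T x) / norm x) ` M)" by (simp add: s_def onorm_on_def)
    then obtain x where x: "x \<in> M" "s - 1 / real (Suc n) < norm (T x) / norm x"
      using less_cSupD[of "(\<lambda>x. norm (T x) / norm x) ` M"] M0 by blast
    show ?thesis
    proof (cases "x = 0")
      \<comment> \<open>A near maximizer of the quotient may be the zero vector; then the target
        value is negative, and any unit vector of M exceeds it.\<close>
      case True
      then have "s - 1 / real (Suc n) < 0" using x(2) by simp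
      then have "s - 1 / real (Suc n) < norm (T ((1 / norm v) *\<^sub>R v))" by (rule less_le_trans) simp
      then show ?thesis using csubspace_unit_vector[OF M(1) v] by blast
    next
      case False
      have "s - 1 / real (Suc n) < norm (T ((1 / norm x) *\<^sub>R x))"
        using x(2) by (simp add: clinear_op_scaleR[OF bounded_ops_clinear[OF T]])
      then show ?thesis using csubspace_unit_vector[OF M(1) x(1) False] by blast
    qed
  qed
  then obtain u where u: "\<And>n. u n \<in> M" "\<And>n. norm (u n) = 1" "\<And>n. s - 1 / real (Suc n) < norm (T (u n))"
    by metis
  have "(\<lambda>n. norm (T (u n))) \<longlonglongrightarrow> s"
  proof (rule tendsto_sandwich)
    show "eventually (\<lambda>n. s - 1 / real (Suc n) \<le> norm (T (u n))) sequentially"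
      using u(3) less_imp_le by (intro always_eventually) blast
    show "eventually (\<lambda>n. norm (T (u n)) \<le> s) sequentially"
      using norm_le_onorm_on[OF T u(1)] u(2) by (intro always_eventually) (simp add: s_def)
    show "(\<lambda>n. s - 1 / real (Suc n)) \<longlonglongrightarrow> s"
      using tendsto_diff[OF tendsto_const[of s] LIMSEQ_Suc[OF lim_1_over_n]] by simp
  qed simp
  then show ?thesis using that u unfolding s_def by blast
qed

section \<open>Compactness and norm attainment\<close>

lemma compact_ops_convergent_subseq:
  fixes u :: "nat \<Rightarrow> 'a::complex_hilbert"
  assumes "K \<in> compact_ops" "\<And>n. norm (u n) \<le> 1"
  obtains r l where "strict_mono r" "(\<lambda>n. K (u (r n))) \<longlonglongrightarrow> l"
proof -
  have "compact (closure (K ` cball 0 1))" using assms by (simp add: compact_ops_def)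
  moreover have "K (u n) \<in> closure (K ` cball 0 1)" for n
    using assms(2)[of n] by (intro subsetD[OF closure_subset] imageI) simp
  ultimately obtain l r where "strict_mono (r::nat\<Rightarrow>nat)" "((\<lambda>n. K (u n)) \<circ> r) \<longlonglongrightarrow> l"
    unfolding compact_def by meson
  then show ?thesis using that by (simp add: o_def)
qed

lemma bounded_ops_image_cball_subset:
  assumes "T \<in> bounded_ops" and V: "range T \<subseteq> cspan B" "finite B"
  obtains r where "T ` cball 0 1 \<subseteq> cspan B \<inter> cball 0 r"
proof -
  obtain c where c: "0 < c" "\<And>x. norm (T x) \<le> c * norm x" using bounded_opsE[OF assms(1)] by blast
  have "norm (T x) \<le> c" if "norm x \<le> 1" for x
    using c(2)[of x] mult_left_mono[OF that, of c] c(1) by linarith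
  then show ?thesis using V by (intro that[of c]) auto
qed

lemma finite_rank_imp_compact:
  assumes "F \<in> finite_rank_ops"
  shows "F \<in> compact_ops"
proof -
  obtain B where b: "F \<in> bounded_ops" and B: "finite B" "range F = cspan B"
    using assms by (auto simp: finite_rank_ops_def cfinite_dim_def)
  obtain r where r: "F ` cball 0 1 \<subseteq> cspan B \<inter> cball 0 r"
    using bounded_ops_image_cball_subset[OF b _ B(1)] B(2) by blast
  have c: "compact (cspan B \<inter> cball 0 r)" using B(1) by (rule compact_cspan_Int_cball)
  have "closure (F ` cball 0 1) \<subseteq> cspan B \<inter> cball 0 r"
    using r compact_imp_closed[OF c] by (rule closure_minimal)
  then have "compact (closure (F ` cball 0 1))"
    using compact_Int_closed[OF c closed_closure] by (metis inf.absorb_iff2)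
  then show ?thesis using b by (simp add: compact_ops_def)
qed

text \<open>\<open>c - T^2\<close> has the comparison of \<open>c |x|^2\<close> with
  \<open>|T x|^2\<close> as its quadratic form, which brings the norm of T on a subspace under
  Cauchy-Schwarz.\<close>

lemma
  assumes T: "T \<in> bounded_ops" "symmetric_op T"
  shows clinear_op_defect: "clinear_op (\<lambda>x. c *\<^sub>R x - T (T x))"
    and symmetric_op_defect: "symmetric_op (\<lambda>x. c *\<^sub>R x - T (T x))"
    and Re_cinner_defect: "Re (cinner (c *\<^sub>R x - T (T x)) x) = c * (norm x)\<^sup>2 - (norm (T x))\<^sup>2"
proof -
  note lin = bounded_ops_clinear[OF T(1)]
  show "clinear_op (\<lambda>x. c *\<^sub>R x - T (T x))"
    by (rule clinear_opI) (simp_all add: clinear_op_simps[OF lin] algebra_simps scaleC_of_real[symmetric]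
      scaleC_scaleC complex_vector.scale_right_diff_distrib mult.commute)
  show "symmetric_op (\<lambda>x. c *\<^sub>R x - T (T x))"
    using symmetric_opD[OF T(2)] by (simp add: symmetric_op_def cinner_simps)
  show "Re (cinner (c *\<^sub>R x - T (T x)) x) = c * (norm x)\<^sup>2 - (norm (T x))\<^sup>2"
    by (simp add: cinner_simps symmetric_opD[OF T(2)] cinner_self del: of_real_power)
qed

text \<open>Writing \<open>s\<close> for the supremum, the form of \<open>s\<^sup>2 - T\<^sup>2\<close> is nonnegative on \<open>M\<close> and tends to \<open>0\<close> along
  a maximizing sequence; Cauchy-Schwarz for this form controls \<open>(s\<^sup>2 - a\<^sup>2) \<cdot>\<close> (differences of the sequence)
  by the compact operator \<open>T\<^sup>2 - a\<^sup>2\<close>.\<close>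

lemma norm_attaining_on_above_shift:
  assumes T: "T \<in> bounded_ops" "symmetric_op T" and M: "csubspace M" "closed M" "M \<noteq> {0}"
    and a: "0 \<le> a" "a < onorm_on M T"
    and G: "\<And>x. T x = a *\<^sub>R x + G x"
      "\<And>u. (\<And>n. norm (u n) \<le> 1) \<Longrightarrow> \<exists>r l. strict_mono (r::nat\<Rightarrow>nat) \<and> (\<lambda>n. G (u (r n))) \<longlonglongrightarrow> l"
  shows "norm_attaining_on M T"
proof -
  define s where "s = onorm_on M T"
  have s0: "0 < s" and sa: "a\<^sup>2 < s\<^sup>2" using a by (auto simp: s_def power_strict_mono)
  note lin = bounded_ops_clinear[OF T(1)]
  obtain u where u: "\<And>n. u n \<in> M" "\<And>n. norm (u n) = 1" "(\<lambda>n. norm (T (u n))) \<longlonglongrightarrow> s"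
    using maximizing_sequence[OF T(1) M(1,3)] unfolding s_def by blast
  obtain r l where r: "strict_mono (r::nat\<Rightarrow>nat)" "(\<lambda>n. G (u (r n))) \<longlonglongrightarrow> l"
    using G(2)[of u] u(2) by auto
  define v where "v n = u (r n)" for n
  have v: "v n \<in> M" "norm (v n) = 1" for n using u by (auto simp: v_def)
  have vs: "(\<lambda>n. norm (T (v n))) \<longlonglongrightarrow> s" 
    using LIMSEQ_subseq_LIMSEQ[OF u(3) r(1)] by (simp add: v_def o_def)
  \<comment> \<open>\<open>T^2 - a^2\<close> factors as \<open>(a + T) G\<close>, so it inherits
    convergence along the subsequence from G.\<close>
  define C where "C x = T (T x) - a\<^sup>2 *\<^sub>R x" for x
  have C: "C x = a *\<^sub>R G x + T (G x)" for x
    by (simp add: C_def G(1)[of x] clinear_op_simps[OF lin] scaleR_right.add power2_eq_square)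
  have "(\<lambda>n. C (v n)) \<longlonglongrightarrow> a *\<^sub>R l + T l"
    unfolding C using r(2)
    by (intro tendsto_intros bounded_linear.tendsto[OF bounded_ops_bounded_linear[OF T(1)]]) (simp_all add: v_def)
  then have CC: "Cauchy (\<lambda>n. C (v n))" by (rule LIMSEQ_imp_Cauchy)
  define A where "A x = s\<^sup>2 *\<^sub>R x - T (T x)" for x
  have A': "A = (\<lambda>x. s\<^sup>2 *\<^sub>R x - T (T x))" by (simp add: A_def fun_eq_iff)
  have linA: "clinear_op A" and symA: "symmetric_op A"
    unfolding A' by (rule clinear_op_defect[OF T] symmetric_op_defect[OF T])+
  have ReA: "Re (cinner (A x) x) = s\<^sup>2 * (norm x)\<^sup>2 - (norm (T x))\<^sup>2" for x
    unfolding A_def by (rule Re_cinner_defect[OF T])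
  have Mle: "norm (T x) \<le> s * norm x" if "x \<in> M" for x
    using norm_le_onorm_on[OF T(1) that] by (simp add: s_def)
  have posA: "0 \<le> Re (cinner (A x) x)" if "x \<in> M" for x
    using power_mono[OF Mle[OF that], of 2] by (simp add: ReA power_mult_distrib)
  \<comment> \<open>The form of A at \<open>v n\<close>. Its limit 0 makes \<open>A (v n)\<close>
    small when paired with vectors of M, although \<open>A (v n)\<close> itself need not lie in
    M.\<close>
  define e where "e n = s\<^sup>2 - (norm (T (v n)))\<^sup>2" for n
  have e0: "e \<longlonglongrightarrow> 0"
    unfolding e_def using tendsto_diff[OF tendsto_const[of "s\<^sup>2"] tendsto_power[OF vs, of 2]] by simp
  have e: "0 \<le> e n" for n using posA[OF v(1)[of n]] by (simp add: ReA e_def v)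
  have small: "cmod (cinner (A (v n)) y) \<le> sqrt (e n) * s * norm y" if y: "y \<in> M" for n y
  proof (rule power2_le_imp_le)
    have "(cmod (cinner (A (v n)) y))\<^sup>2 \<le> Re (cinner (A (v n)) (v n)) * Re (cinner (A y) y)"
      by (rule psd_Cauchy_Schwarz[OF linA symA M(1) posA v(1) y])
    also have "\<dots> \<le> e n * (s\<^sup>2 * (norm y)\<^sup>2)"
      using e posA[OF y] by (intro mult_mono) (auto simp: ReA e_def v)
    finally show "(cmod (cinner (A (v n)) y))\<^sup>2 \<le> (sqrt (e n) * s * norm y)\<^sup>2"
      using e by (simp add: power_mult_distrib mult_ac)
  qed (use e s0 in simp)
  have diff: "(s\<^sup>2 - a\<^sup>2) * norm (v m - v n) \<le> norm (C (v m) - C (v n)) + s * (sqrt (e m) + sqrt (e n))" for m n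
  proof (cases "v m = v n")
    case False
    define y where "y = v m - v n"
    have y: "y \<in> M" "0 < norm y"
      using v(1) False by (auto simp: y_def complex_vector.subspace_diff[OF M(1)])
    \<comment> \<open>\<open>s^2 - a^2\<close> is the sum of \<open>T^2 - a^2\<close> and
      \<open>s^2 - T^2\<close>; after pairing with y, which lies in M, the second summand is
      controlled by \<open>small\<close>.\<close>
    have "(s\<^sup>2 - a\<^sup>2) *\<^sub>R y = (C (v m) - C (v n)) + (A (v m) - A (v n))"
      by (simp add: y_def C_def A_def algebra_simps)
    then have "cinner ((s\<^sup>2 - a\<^sup>2) *\<^sub>R y) y = cinner (C (v m) - C (v n)) y + (cinner (A (v m)) y - cinner (A (v n)) y)"
      by (simp add: cinner_simps)
    then have "(s\<^sup>2 - a\<^sup>2) * (norm y)\<^sup>2 = Re (cinner (C (v m) - C (v n)) y) + (Re (cinner (A (v m)) y) - Re (cinner (A (v n)) y))"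
      by (simp only: cinner_scaleR_left cinner_self of_real_mult[symmetric] plus_complex.sel minus_complex.sel complex_eq_iff Re_complex_of_real)
    also have "\<dots> \<le> norm (C (v m) - C (v n)) * norm y + (sqrt (e m) * s * norm y + sqrt (e n) * s * norm y)"
      using Re_cinner_le[of "C (v m) - C (v n)" y] small[OF y(1), of m] small[OF y(1), of n]
        abs_Re_le_cmod[of "cinner (A (v m)) y"] abs_Re_le_cmod[of "cinner (A (v n)) y"] by linarith
    finally have "((s\<^sup>2 - a\<^sup>2) * norm y) * norm y \<le> (norm (C (v m) - C (v n)) + s * (sqrt (e m) + sqrt (e n))) * norm y"
      by (simp add: power2_eq_square algebra_simps)
    then show ?thesis using y(2) by (simp add: y_def)
  qed (use e s0 in simp)
  have "Cauchy v"
  proof (rule metric_CauchyI)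
    fix \<epsilon> :: real assume \<epsilon>: "0 < \<epsilon>"
    define \<delta> where "\<delta> = (s\<^sup>2 - a\<^sup>2) * \<epsilon> / 3"
    have \<delta>: "0 < \<delta>" using sa \<epsilon> by (simp add: \<delta>_def)
    obtain N1 where N1: "\<And>m n. m \<ge> N1 \<Longrightarrow> n \<ge> N1 \<Longrightarrow> norm (C (v m) - C (v n)) < \<delta>"
      using CauchyD[OF CC \<delta>] by blast
    have "(\<lambda>n. s * sqrt (e n)) \<longlonglongrightarrow> 0"
      using tendsto_mult[OF tendsto_const[of s] tendsto_real_sqrt[OF e0]] by simp
    then obtain N2 where N2: "\<And>n. n \<ge> N2 \<Longrightarrow> norm (s * sqrt (e n)) < \<delta>"
      using LIMSEQ_D[OF _ \<delta>] by fastforce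
    have "dist (v m) (v n) < \<epsilon>" if "max N1 N2 \<le> m" "max N1 N2 \<le> n" for m n
    proof -
      have "norm (C (v m) - C (v n)) < \<delta>" "s * sqrt (e m) < \<delta>" "s * sqrt (e n) < \<delta>"
        using that N1[of m n] N2[of m] N2[of n] by auto
      then have "(s\<^sup>2 - a\<^sup>2) * norm (v m - v n) < (s\<^sup>2 - a\<^sup>2) * \<epsilon>"
        using diff[of m n] by (simp add: \<delta>_def distrib_left)
      then show ?thesis using sa by (simp add: dist_norm)
    qed
    then show "\<exists>N. \<forall>m\<ge>N. \<forall>n\<ge>N. dist (v m) (v n) < \<epsilon>" by blast
  qed
  then obtain x where x: "v \<longlonglongrightarrow> x" using Cauchy_convergent convergent_def by blast
  have xM: "x \<in> M" using M(2) v(1) x by (metis closed_sequentially)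
  have "norm x = 1" using LIMSEQ_unique[OF tendsto_norm[OF x]] v(2) by simp
  moreover have "norm (T x) = s"
    using LIMSEQ_unique[OF tendsto_norm[OF bounded_linear.tendsto[OF bounded_ops_bounded_linear[OF T(1)] x]] vs] .
  ultimately show ?thesis using xM by (auto simp: norm_attaining_on_def s_def)
qed

lemma norm_attaining_on_finite_dim:
  assumes T: "T \<in> bounded_ops" and M: "csubspace M" "M \<noteq> {0}" "cfinite_dim M"
  shows "norm_attaining_on M T"
proof -
  define s where "s = onorm_on M T"
  obtain u where u: "\<And>n. u n \<in> M" "\<And>n. norm (u n) = 1" "(\<lambda>n. norm (T (u n))) \<longlonglongrightarrow> s"
    using maximizing_sequence[OF T M(1,2)] unfolding s_def by blast
  obtain B where "finite B" "M = cspan B" using M(3) by (auto simp: cfinite_dim_def)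
  then have "compact (M \<inter> cball 0 1)" using compact_cspan_Int_cball by blast
  moreover have "\<forall>n. u n \<in> M \<inter> cball 0 1" using u by simp
  ultimately obtain x r where x: "x \<in> M" and r: "strict_mono (r::nat\<Rightarrow>nat)" "(u \<circ> r) \<longlonglongrightarrow> x"
    unfolding compact_def by (metis IntD1)
  have "norm x = 1" using LIMSEQ_unique[OF tendsto_norm[OF r(2)]] u(2) by simp
  moreover have "norm (T x) = s"
    using LIMSEQ_unique[OF tendsto_norm[OF bounded_linear.tendsto[OF bounded_ops_bounded_linear[OF T] r(2)]]]
      LIMSEQ_subseq_LIMSEQ[OF u(3) r(1)] by (simp add: o_def)
  ultimately show ?thesis using x by (auto simp: norm_attaining_on_def s_def)
qed

lemma AN_of_compact_finite_rank:
  assumes T: "T \<in> bounded_ops" and K: "K \<in> compact_ops" "positive_op K"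
    and F: "F \<in> finite_rank_ops" "positive_op F" and a: "0 \<le> a" and TKF: "\<And>x. T x = a *\<^sub>R x + K x - F x"
  shows "T \<in> AN_ops"
proof -
  have KF: "K \<in> bounded_ops" "F \<in> bounded_ops" "symmetric_op K" "symmetric_op F"
    using K F by (auto simp: positive_op_iff)
  have sym: "symmetric_op T"
    using KF by (simp add: symmetric_op_def TKF cinner_simps)
  have "norm_attaining_on M T" if M: "csubspace M" "closed M" "M \<noteq> {0}" for M
  proof (cases "a < onorm_on M T")
    case True
    show ?thesis
    proof (rule norm_attaining_on_above_shift[OF T sym M a True])
      show "T x = a *\<^sub>R x + (K x - F x)" for x by (simp add: TKF)
      fix u :: "nat \<Rightarrow> 'a" assume u: "\<And>n. norm (u n) \<le> 1"
      obtain r l where r: "strict_mono r" "(\<lambda>n. K (u (r n))) \<longlonglongrightarrow> l"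
        using compact_ops_convergent_subseq[of K u] K u by blast
      obtain r' l' where r': "strict_mono r'" "(\<lambda>n. F (u (r (r' n)))) \<longlonglongrightarrow> l'"
        using compact_ops_convergent_subseq[of F "\<lambda>n. u (r n)"] finite_rank_imp_compact[OF F(1)] u by blast
      have "(\<lambda>n. K (u (r (r' n))) - F (u (r (r' n)))) \<longlonglongrightarrow> l - l'"
        using tendsto_diff[OF LIMSEQ_subseq_LIMSEQ[OF r(2) r'(1)] r'(2)] by (simp add: o_def)
      then show "\<exists>r l. strict_mono (r::nat\<Rightarrow>nat) \<and> (\<lambda>n. K (u (r n)) - F (u (r n))) \<longlonglongrightarrow> l"
        using strict_mono_o[OF r(1) r'(1)] by (intro exI[of _ "r \<circ> r'"] exI[of _ "l - l'"]) simp
    qed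
  next
    case False
    show ?thesis
    proof (cases "\<exists>x\<in>M. F x = 0 \<and> x \<noteq> 0")
      case True
      then obtain x0 where x0: "x0 \<in> M" "F x0 = 0" "x0 \<noteq> 0" by blast
      define x where "x = (1 / norm x0) *\<^sub>R x0"
      have x: "x \<in> M" "norm x = 1" using csubspace_unit_vector[OF M(1) x0(1,3)] by (auto simp: x_def)
      have Fx: "F x = 0" using x0(2) by (simp add: x_def clinear_op_scaleR[OF bounded_ops_clinear[OF KF(2)]])
      have "a \<le> Re (cinner (T x) x)"
        using K(2) x(2) by (simp add: TKF Fx cinner_simps cinner_self positive_op_iff)
      also have "\<dots> \<le> norm (T x)" using Re_cinner_le[of "T x" x] x(2) by simp
      finally have "onorm_on M T \<le> norm (T x)" using False by simp
      then have "norm (T x) = onorm_on M T" using norm_le_onorm_on[OF T x(1)] x(2) by simp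
      then show ?thesis using x by (auto simp: norm_attaining_on_def)
    next
      case False
      \<comment> \<open>F is injective on M, so its finite dimensional range bounds the dimension of
        M.\<close>
      then have "cfinite_dim M"
        using F(1) by (intro cfinite_dim_if_injective_image[OF bounded_ops_clinear[OF KF(2)] M(1), of "range F"])
          (auto simp: finite_rank_ops_def)
      then show ?thesis by (rule norm_attaining_on_finite_dim[OF T M(1,3)])
    qed
  qed
  then show ?thesis using T by (auto simp: AN_ops_def)
qed


section \<open>Eigenvectors of positive absolutely norm attaining operators\<close>

lemma cinner_square_sum_orthogonal:
  assumes "cinner x y = 0"
  shows "(norm (a *\<^sub>R x + b *\<^sub>R (y::'a::complex_inner)))\<^sup>2 = a\<^sup>2 * (norm x)\<^sup>2 + b\<^sup>2 * (norm y)\<^sup>2"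
  using pythagoras[of "a *\<^sub>R x" "b *\<^sub>R y"] assms by (simp add: cinner_simps power_mult_distrib)

lemma AN_opsD:
  assumes "T \<in> AN_ops" "csubspace M" "closed M" "M \<noteq> {0}"
  obtains x where "x \<in> M" "norm x = 1" "\<And>y. y \<in> M \<Longrightarrow> norm (T y) \<le> norm (T x) * norm y"
  using assms norm_attaining_on_iff[of T M] by (auto simp: AN_ops_def)

text \<open>A maximizing vector is isotropic for the nonnegative form of \<open>\<parallel>T x\<parallel>\<^sup>2 - T\<^sup>2\<close>, hence lies in its radical.\<close>

lemma maximizer_radical:
  assumes T: "T \<in> bounded_ops" "symmetric_op T" and M: "csubspace M" and x: "x \<in> M" "norm x = 1"
    and le: "\<And>y. y \<in> M \<Longrightarrow> norm (T y) \<le> norm (T x) * norm y" and y: "y \<in> M"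
  shows "cinner ((norm (T x))\<^sup>2 *\<^sub>R x - T (T x)) y = 0"
proof -
  have "(cmod (cinner ((norm (T x))\<^sup>2 *\<^sub>R x - T (T x)) y))\<^sup>2
      \<le> Re (cinner ((norm (T x))\<^sup>2 *\<^sub>R x - T (T x)) x) * Re (cinner ((norm (T x))\<^sup>2 *\<^sub>R y - T (T y)) y)"
  proof (rule psd_Cauchy_Schwarz[OF clinear_op_defect[OF T] symmetric_op_defect[OF T] M _ x(1) y])
    show "0 \<le> Re (cinner ((norm (T x))\<^sup>2 *\<^sub>R z - T (T z)) z)" if "z \<in> M" for z
      using power_mono[OF le[OF that], of 2] by (simp add: Re_cinner_defect[OF T] power_mult_distrib)
  qed
  then show ?thesis by (simp add: Re_cinner_defect[OF T] x)
qed

text \<open>Invariance puts \<open>|T v|^2 v - T^2 v\<close> into M, so it is orthogonal to itself.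
  With \<open>c = |T v|\<close> this says \<open>(T + c) (T - c) v = 0\<close>, and a positive
  operator has no eigenvalue \<open>-c\<close> unless \<open>c = 0\<close>.\<close>

lemma AN_top_eigenvector:
  assumes T: "T \<in> AN_ops" "positive_op T" and M: "csubspace M" "closed M" "M \<noteq> {0}"
    and inv: "\<And>x. x \<in> M \<Longrightarrow> T x \<in> M"
  obtains v where "v \<in> M" "norm v = 1" "T v = norm (T v) *\<^sub>R v" "\<And>x. x \<in> M \<Longrightarrow> norm (T x) \<le> norm (T v) * norm x"
proof -
  have b: "T \<in> bounded_ops" "symmetric_op T" and pos: "\<And>x. 0 \<le> Re (cinner (T x) x)"
    using T(2) by (auto simp: positive_op_iff)
  note lin = bounded_ops_clinear[OF b(1)]
  obtain v where v: "v \<in> M" "norm v = 1" "\<And>y. y \<in> M \<Longrightarrow> norm (T y) \<le> norm (T v) * norm y"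
    using AN_opsD[OF T(1) M] by blast
  define c where "c = norm (T v)"
  define w where "w = c\<^sup>2 *\<^sub>R v - T (T v)"
  have "w \<in> M" unfolding w_def scaleC_of_real[symmetric]
    by (intro complex_vector.subspace_diff complex_vector.subspace_scale M inv v)
  then have "cinner w w = 0"
    using maximizer_radical[OF b M(1) v] by (simp add: w_def c_def)
  then have "w = 0" by (simp only: cinner_self_eq_zero)
  then have TT: "T (T v) = c\<^sup>2 *\<^sub>R v" by (simp add: w_def)
  define y where "y = T v - c *\<^sub>R v"
  have "T y = - (c *\<^sub>R y)"
    by (simp add: y_def clinear_op_simps[OF lin] TT power2_eq_square algebra_simps)
  then have "0 \<le> - (c * (norm y)\<^sup>2)"
    using pos[of y] by (simp add: cinner_simps cinner_self del: of_real_power)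
  moreover have "0 \<le> c" by (simp add: c_def)
  ultimately have "c = 0 \<or> y = 0"
    by (metis mult_pos_pos neg_0_le_iff_le not_le order_le_less zero_less_norm_iff zero_less_power)
  then have "T v = c *\<^sub>R v" by (auto simp: y_def c_def)
  then show ?thesis using that v by (simp add: c_def)
qed

lemma orth_eigenvectors_invariant:
  assumes "symmetric_op T" "\<And>v. v \<in> S \<Longrightarrow> \<exists>c. T v = c *\<^sub>R v" "x \<in> orth S"
  shows "T x \<in> orth S"
proof (rule orthI)
  fix v assume v: "v \<in> S"
  then obtain c where "T v = c *\<^sub>R v" using assms(2) by blast
  then show "cinner (T x) v = 0"
    using orthD[OF assms(3) v] symmetric_opD[OF assms(1), of x v] by (simp add: cinner_simps)
qed

lemma orth_invariant:
  assumes "symmetric_op T" "\<And>v. v \<in> S \<Longrightarrow> T v \<in> S" "x \<in> orth S"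
  shows "T x \<in> orth S"
  using orthD[OF assms(3) assms(2)] by (intro orthI) (simp add: symmetric_opD[OF assms(1)])

text \<open>Otherwise projection onto the span of S would fix every vector of V. This keeps the
  recursive choice of eigenvectors from ending.\<close>

lemma infinite_dim_Int_orth:
  assumes V: "csubspace (V :: 'a::complex_hilbert set)" "\<not> cfinite_dim V" and S: "finite S" "S \<subseteq> V"
  shows "V \<inter> orth S \<noteq> {0}"
proof
  assume eq: "V \<inter> orth S = {0}"
  have C: "csubspace (cspan S)" "closed (cspan S)" using closed_cspan_finite[OF S(1)] by simp_all
  have sub: "cspan S \<subseteq> V" using S(2) V(1) by (rule complex_vector.span_minimal)
  have "x \<in> cspan S" if x: "x \<in> V" for x
  proof -
    have "x - proj (cspan S) x \<in> V"
      using subsetD[OF sub proj_mem[OF C]] by (rule complex_vector.subspace_diff[OF V(1) x])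
    moreover have "x - proj (cspan S) x \<in> orth S" using proj_orth[OF C] by (simp add: orth_cspan)
    ultimately have "x - proj (cspan S) x = 0" using eq by blast
    then show ?thesis using proj_mem[OF C, of x] by simp
  qed
  then have "V = cspan S" using sub by blast
  then show False using V(2) S(1) by (auto simp: cfinite_dim_def)
qed

text \<open>Each \<open>e n\<close> is a top eigenvector on the part of V orthogonal to its
  predecessors, which T preserves because they are eigenvectors.\<close>

lemma AN_eigenvector_sequence:
  assumes T: "T \<in> AN_ops" "positive_op T" and V: "csubspace V" "closed V" "\<not> cfinite_dim V"
    and inv: "\<And>x. x \<in> V \<Longrightarrow> T x \<in> V"
  obtains e :: "nat \<Rightarrow> 'a::complex_hilbert"
  where "\<And>n. e n \<in> V" "\<And>n. norm (e n) = 1" "\<And>n. T (e n) = norm (T (e n)) *\<^sub>R e n"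
    "\<And>m n. m \<noteq> n \<Longrightarrow> cinner (e m) (e n) = 0"
    "\<And>n x. x \<in> V \<Longrightarrow> x \<in> orth (e ` {..<n}) \<Longrightarrow> norm (T x) \<le> norm (T (e n)) * norm x"
    "decseq (\<lambda>n. norm (T (e n)))"
proof -
  define P where "P e n v \<longleftrightarrow> v \<in> V \<and> v \<in> orth (e ` {..<n}) \<and> norm v = 1 \<and> T v = norm (T v) *\<^sub>R v
      \<and> (\<forall>x\<in>V \<inter> orth (e ` {..<n}). norm (T x) \<le> norm (T v) * norm x)" for e :: "nat \<Rightarrow> 'a" and n v
  have sym: "symmetric_op T" using T(2) by (simp add: positive_op_iff)
  have "\<exists>e. \<forall>n::nat. P e n (e n)"
  \<comment> \<open>The choice at n depends on all earlier values; the first goal checks that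
    \<open>P e n\<close> sees e only below n.\<close>
  proof (rule dependent_wellorder_choice)
    fix r and e e' :: "nat \<Rightarrow> 'a" and n assume "\<And>m. m < n \<Longrightarrow> e m = e' m"
    then have "e ` {..<n} = e' ` {..<n}" by auto
    then show "P e n r = P e' n r" by (simp add: P_def)
  next
    fix n and e :: "nat \<Rightarrow> 'a" assume prev: "\<And>m. m < n \<Longrightarrow> P e m (e m)"
    define W where "W = V \<inter> orth (e ` {..<n})"
    have W: "csubspace W" "closed W"
      unfolding W_def using V by (auto intro: complex_vector.subspace_inter csubspace_orth closed_Int closed_orth)
    have W0: "W \<noteq> {0}"
      unfolding W_def using prev by (intro infinite_dim_Int_orth V) (auto simp: P_def)
    have "T x \<in> W" if "x \<in> W" for x
    proof -
      have "\<exists>c. T v = c *\<^sub>R v" if "v \<in> e ` {..<n}" for v using prev that by (auto simp: P_def)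
      then show ?thesis
        using that inv orth_eigenvectors_invariant[OF sym, of "e ` {..<n}" x] by (simp add: W_def)
    qed
    then obtain v where "v \<in> W" "norm v = 1" "T v = norm (T v) *\<^sub>R v" "\<And>x. x \<in> W \<Longrightarrow> norm (T x) \<le> norm (T v) * norm x"
      using AN_top_eigenvector[OF T W W0] by blast
    then show "\<exists>v. P e n v" unfolding P_def W_def by blast
  qed
  then obtain e where e: "\<And>n. P e n (e n)" by blast
  have lt: "cinner (e m) (e n) = 0" if "n < m" for m n
    using e[of m] that by (auto simp: P_def intro: orthD)
  show ?thesis
  proof
    show "cinner (e m) (e n) = 0" if "m \<noteq> n" for m n
      using that lt[of m n] lt[of n m] by (metis cinner_eq_zero_commute linorder_neqE_nat)
    \<comment> \<open>For \<open>m \<le> n\<close>, the vector \<open>e n\<close> lies in the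
      subspace on which \<open>e m\<close> is maximal.\<close>
    have "norm (T (e n)) \<le> norm (T (e m))" if "m \<le> n" for m n
    proof -
      have "e n \<in> orth (e ` {..<m})" using lt that by (auto intro!: orthI)
      then show ?thesis using e[of m] e[of n] unfolding P_def by (metis IntI mult.right_neutral)
    qed
    then show "decseq (\<lambda>n. norm (T (e n)))" by (simp add: decseq_def)
  qed (use e in \<open>auto simp: P_def\<close>)
qed

text \<open>On the closed span M of the \<open>g n\<close> the form of \<open>T^2\<close> is
  diagonal. The radical equation of a maximizer x becomes
  \<open>(|T x|^2 - |T (g n)|^2) * cinner x (g n) = 0\<close>. Strict increase keeps the first
  factor nonzero, so x is orthogonal to M, which contains it.\<close>

lemma AN_no_increasing_orthogonal_images:
  fixes g :: "nat \<Rightarrow> 'a::complex_hilbert"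
  assumes T: "T \<in> AN_ops" "symmetric_op T"
    and g: "\<And>n. norm (g n) = 1" "\<And>m n. m \<noteq> n \<Longrightarrow> cinner (g m) (g n) = 0"
    and Tg: "\<And>m n. m \<noteq> n \<Longrightarrow> cinner (T (g m)) (T (g n)) = 0"
    and incr: "\<And>n. norm (T (g n)) < norm (T (g (Suc n)))"
  shows False
proof -
  have b: "T \<in> bounded_ops" using T(1) by (simp add: AN_ops_def)
  note lin = bounded_ops_clinear[OF b]
  define M where "M = closure (cspan (range g))"
  have M: "csubspace M" "closed M" unfolding M_def by (auto intro: csubspace_closure)
  have gM: "g n \<in> M" for n
    unfolding M_def by (intro subsetD[OF closure_subset] complex_vector.span_base) simp
  have "g 0 \<noteq> 0" using g(1)[of 0] by auto
  then have "M \<noteq> {0}" using gM[of 0] by blast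
  then obtain x where x: "x \<in> M" "norm x = 1" "\<And>y. y \<in> M \<Longrightarrow> norm (T y) \<le> norm (T x) * norm y"
    using AN_opsD[OF T(1) M] by blast
  \<comment> \<open>Checked on the generators, then extended by linearity and continuity to the
    closed span.\<close>
  have coef: "cinner (T z) (T (g n)) = (norm (T (g n)))\<^sup>2 * cinner z (g n)" if "z \<in> M" for z n
  proof -
    define E where "E = {z. cinner (T z) (T (g n)) = (norm (T (g n)))\<^sup>2 * cinner z (g n)}"
    have "csubspace E"
      by (rule complex_vector.subspaceI) (auto simp: E_def clinear_op_simps[OF lin] cinner_simps algebra_simps)
    moreover have "g m \<in> E" for m
    proof (cases "m = n")
      case False
      then show ?thesis using Tg g(2) by (simp add: E_def)
    qed (simp add: E_def cinner_self g(1))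
    ultimately have "cspan (range g) \<subseteq> E" by (intro complex_vector.span_minimal) auto
    moreover have "closed E"
      unfolding E_def
      by (intro closed_Collect_eq continuous_intros continuous_on_cinner
          linear_continuous_on bounded_ops_bounded_linear b)
    ultimately have "M \<subseteq> E" unfolding M_def by (rule closure_minimal)
    then show ?thesis using that by (auto simp: E_def)
  qed
  have "cinner x (g n) = 0" for n
  proof -
    have "cinner ((norm (T x))\<^sup>2 *\<^sub>R x - T (T x)) (g n) = 0"
      by (rule maximizer_radical[OF b T(2) M(1) x gM])
    then have "complex_of_real ((norm (T x))\<^sup>2 - (norm (T (g n)))\<^sup>2) * cinner x (g n) = 0"
      using coef[OF x(1), of n] symmetric_opD[OF T(2), of "T x" "g n"] by (simp add: cinner_simps algebra_simps)
    moreover have "norm (T (g n)) < norm (T x)"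
      using incr[of n] x(3)[OF gM, of "Suc n"] g(1) by simp
    then have "(norm (T (g n)))\<^sup>2 < (norm (T x))\<^sup>2" by (simp add: power_strict_mono)
    ultimately show ?thesis by (metis diff_gt_0_iff_gt mult_eq_0_iff of_real_eq_0_iff order_less_irrefl)
  qed
  then have "x \<in> orth M" unfolding M_def orth_closure orth_cspan by (auto intro: orthI)
  then show False using orth_Int_self x by fastforce
qed

text \<open>If all \<open>\<mu>\<^sub>n\<close> stay below all \<open>\<nu>\<^sub>n\<close>, the vectors \<open>c\<^sub>n e\<^sub>n + s\<^sub>n f\<^sub>n\<close> can be rotated so that
  their images have any prescribed norms between \<open>b\<close> and \<open>a\<close>, in particular strictly increasing ones.\<close>

lemma AN_eigenvalues_not_separated:
  fixes e f :: "nat \<Rightarrow> 'a::complex_hilbert" and \<nu> \<mu> :: "nat \<Rightarrow> real"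
  assumes T: "T \<in> AN_ops" "symmetric_op T"
    and e: "\<And>n. norm (e n) = 1" "\<And>m n. m \<noteq> n \<Longrightarrow> cinner (e m) (e n) = 0" "\<And>n. T (e n) = \<nu> n *\<^sub>R e n"
    and f: "\<And>n. norm (f n) = 1" "\<And>m n. m \<noteq> n \<Longrightarrow> cinner (f m) (f n) = 0" "\<And>n. T (f n) = \<mu> n *\<^sub>R f n"
    and ef: "\<And>m n. cinner (e m) (f n) = 0"
    and a: "\<And>n. a \<le> \<nu> n" and b: "\<And>n. 0 \<le> \<mu> n" "\<And>n. \<mu> n \<le> b"
  shows "a \<le> b"
proof (rule ccontr)
  assume "\<not> a \<le> b"
  then have ba: "b < a" by simp
  have b0: "0 \<le> b" using b order_trans by blast
  have fe: "cinner (f m) (e n) = 0" for m n using ef cinner_eq_zero_commute by blast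
  \<comment> \<open>Strictly increasing, from \<open>b^2\<close> at 0 towards \<open>a^2\<close>;
    these become the squared norms of the images.\<close>
  define \<tau> where "\<tau> n = a\<^sup>2 - (a\<^sup>2 - b\<^sup>2) / real (Suc n)" for n
  have ab: "b\<^sup>2 < a\<^sup>2" using ba b0 by (simp add: power_strict_mono)
  have \<tau>: "b\<^sup>2 \<le> \<tau> n" "\<tau> n \<le> a\<^sup>2" "\<tau> n < \<tau> (Suc n)" for n
    using ab by (simp_all add: \<tau>_def field_simps mult_left_mono)
  have \<mu>: "(\<mu> n)\<^sup>2 \<le> b\<^sup>2" for n using b by (simp add: power_mono)
  have \<nu>: "a\<^sup>2 \<le> (\<nu> n)\<^sup>2" for n using a[of n] ba b0 by (intro power_mono) auto
  \<comment> \<open>The weight that solves \<open>q * \<nu>^2 + (1 - q) * \<mu>^2 = \<tau>\<close>;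
    it lies between 0 and 1 because
    \<open>\<mu>^2 \<le> b^2 \<le> \<tau> \<le> a^2 \<le> \<nu>^2\<close>.\<close>
  define q where "q n = (\<tau> n - (\<mu> n)\<^sup>2) / ((\<nu> n)\<^sup>2 - (\<mu> n)\<^sup>2)" for n
  have q: "0 \<le> q n" "q n \<le> 1" "q n * (\<nu> n)\<^sup>2 + (1 - q n) * (\<mu> n)\<^sup>2 = \<tau> n" for n
  proof -
    have "0 < (\<nu> n)\<^sup>2 - (\<mu> n)\<^sup>2" using \<mu>[of n] \<nu>[of n] ab by linarith
    then show "0 \<le> q n" "q n \<le> 1" and "q n * (\<nu> n)\<^sup>2 + (1 - q n) * (\<mu> n)\<^sup>2 = \<tau> n"
      using \<tau>[of n] \<mu>[of n] \<nu>[of n]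
        nonzero_divide_eq_eq[of "(\<nu> n)\<^sup>2 - (\<mu> n)\<^sup>2" "\<tau> n - (\<mu> n)\<^sup>2" "q n"]
      by (simp_all add: q_def[symmetric] algebra_simps) (simp_all add: q_def)
  qed
  define g where "g n = sqrt (q n) *\<^sub>R e n + sqrt (1 - q n) *\<^sub>R f n" for n
  have Tg: "T (g n) = (sqrt (q n) * \<nu> n) *\<^sub>R e n + (sqrt (1 - q n) * \<mu> n) *\<^sub>R f n" for n
    using T(1) bounded_ops_clinear[of T]
    by (simp add: g_def AN_ops_def clinear_op_simps e f)
  have norm_Tg: "(norm (T (g n)))\<^sup>2 = \<tau> n" for n
    unfolding Tg using q[of n]
    by (subst cinner_square_sum_orthogonal[OF ef]) (simp add: e f power_mult_distrib)
  show False
  proof (rule AN_no_increasing_orthogonal_images[OF T])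
    show "norm (g n) = 1" for n
    proof -
      have "(norm (g n))\<^sup>2 = 1\<^sup>2"
        unfolding g_def using q[of n] by (subst cinner_square_sum_orthogonal[OF ef]) (simp add: e f)
      then show ?thesis by (simp only: power2_eq_iff_nonneg norm_ge_zero zero_le_one)
    qed
    show "cinner (g m) (g n) = 0" "cinner (T (g m)) (T (g n)) = 0" if "m \<noteq> n" for m n
      using that by (simp_all add: Tg) (simp_all add: g_def cinner_simps e f ef fe)
    show "norm (T (g n)) < norm (T (g (Suc n)))" for n
      by (rule power2_less_imp_less) (simp_all add: norm_Tg \<tau>)
  qed
qed


section \<open>The decomposition\<close>

text \<open>Compactness can thus be checked with a separate compact set for each tolerance, without
  naming approximating operators.\<close>

lemma compact_opsI_approx:
  assumes K: "K \<in> bounded_ops"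
    and approx: "\<And>\<epsilon>. 0 < \<epsilon> \<Longrightarrow> \<exists>C. compact C \<and> (\<forall>x. norm x \<le> 1 \<longrightarrow> (\<exists>y\<in>C. norm (K x - y) \<le> \<epsilon>))"
  shows "K \<in> compact_ops"
proof -
  have "\<exists>k. finite k \<and> closure (K ` cball 0 1) \<subseteq> (\<Union>x\<in>k. ball x \<epsilon>)" if \<epsilon>: "0 < \<epsilon>" for \<epsilon>
  proof -
    obtain C where C: "compact C" "\<And>x. norm x \<le> 1 \<Longrightarrow> \<exists>y\<in>C. norm (K x - y) \<le> \<epsilon> / 4"
      using approx[of "\<epsilon> / 4"] \<epsilon> by auto
    obtain k where k: "finite k" "C \<subseteq> (\<Union>x\<in>k. ball x (\<epsilon> / 4))"
      using C(1) \<epsilon> unfolding compact_eq_totally_bounded by (meson divide_pos_pos zero_less_numeral)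
    \<comment> \<open>Closed balls of half the radius: their finite union is closed, so it contains
      the closure as well, and it fits into the open balls of radius \<epsilon>.\<close>
    have "K ` cball 0 1 \<subseteq> (\<Union>x\<in>k. cball x (\<epsilon> / 2))"
    proof clarify
      fix x :: 'a assume "x \<in> cball 0 1"
      then obtain y where y: "y \<in> C" "norm (K x - y) \<le> \<epsilon> / 4" using C(2)[of x] by auto
      then obtain z where z: "z \<in> k" "dist z y < \<epsilon> / 4" using k(2) by auto
      have "dist z (K x) \<le> \<epsilon> / 2"
        using dist_triangle[of z "K x" y] y(2) z(2) by (simp add: dist_norm norm_minus_commute)
      then show "K x \<in> (\<Union>x\<in>k. cball x (\<epsilon> / 2))" using z(1) by auto
    qed
    moreover have "closed (\<Union>x\<in>k. cball x (\<epsilon> / 2))" using k(1) by (intro closed_UN) auto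
    ultimately have "closure (K ` cball 0 1) \<subseteq> (\<Union>x\<in>k. cball x (\<epsilon> / 2))" by (rule closure_minimal)
    also have "\<dots> \<subseteq> (\<Union>x\<in>k. ball x \<epsilon>)" using \<epsilon> by force
    finally show ?thesis using k(1) by blast
  qed
  then have "compact (closure (K ` cball 0 1))"
    unfolding compact_eq_totally_bounded complete_eq_closed by simp
  then show ?thesis using K by (simp add: compact_ops_def)
qed

text \<open>Splitting off the last eigenvector adds \<open>\<nu> n\<close> times a squared norm to
  the form; the cross terms vanish by orthogonality and symmetry.\<close>

lemma psd_on_eigenvector_span:
  fixes e :: "nat \<Rightarrow> 'a::complex_hilbert"
  assumes lin: "clinear_op S" and sym: "symmetric_op S"
    and e: "\<And>m n. m \<noteq> n \<Longrightarrow> cinner (e m) (e n) = 0" "\<And>n. S (e n) = \<nu> n *\<^sub>R e n" "\<And>n. 0 \<le> \<nu> n"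
    and z: "z \<in> cspan (e ` {..<n})"
  shows "0 \<le> Re (cinner (S z) z)"
  using z
proof (induction n arbitrary: z)
  case 0
  then show ?case by (simp add: complex_vector.span_empty)
next
  case (Suc n)
  then have "z \<in> cspan (insert (e n) (e ` {..<n}))" by (simp add: lessThan_Suc)
  then obtain c where y: "z - c *\<^sub>C e n \<in> cspan (e ` {..<n})"
    unfolding complex_vector.span_insert by blast
  define y where "y = z - c *\<^sub>C e n"
  have "e n \<in> orth (cspan (e ` {..<n}))" unfolding orth_cspan using e(1) by (auto intro!: orthI)
  then have 0: "cinner (e n) y = 0" "cinner y (e n) = 0"
    using y by (auto simp: y_def dest: orthD orthD')
  have 1: "cinner (S y) (e n) = 0" using 0 by (simp add: symmetric_opD[OF sym] e(2) cinner_simps)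
  have z: "z = y + c *\<^sub>C e n" by (simp add: y_def)
  have "cinner (S z) z = cinner (S y) y + of_real (\<nu> n) * cinner (c *\<^sub>C e n) (c *\<^sub>C e n)"
    by (simp add: z clinear_op_simps[OF lin] e(2) cinner_simps 0 1 mult_ac)
  then have "Re (cinner (S z) z) = Re (cinner (S y) y) + \<nu> n * (norm (c *\<^sub>C e n))\<^sup>2"
    by (simp only: cinner_self of_real_mult[symmetric] plus_complex.sel Re_complex_of_real)
  then show ?case using Suc.IH[of y] y e(3)[of n] by (simp add: y_def)
qed

lemma cspan_range_eq_Union: "cspan (range (e :: nat \<Rightarrow> 'a::complex_vector)) = (\<Union>n. cspan (e ` {..<n}))"
proof
  have mono: "cspan (e ` {..<m}) \<subseteq> cspan (e ` {..<n})" if "m \<le> n" for m n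
    using that by (intro complex_vector.span_mono) auto
  have "csubspace (\<Union>n. cspan (e ` {..<n}))"
  proof (rule complex_vector.subspaceI)
    show "0 \<in> (\<Union>n. cspan (e ` {..<n}))" by (auto intro: complex_vector.span_zero)
    fix x y assume "x \<in> (\<Union>n. cspan (e ` {..<n}))" "y \<in> (\<Union>n. cspan (e ` {..<n}))"
    then obtain m n where "x \<in> cspan (e ` {..<m})" "y \<in> cspan (e ` {..<n})" by blast
    then have "x \<in> cspan (e ` {..<max m n})" "y \<in> cspan (e ` {..<max m n})"
      using mono[of m "max m n"] mono[of n "max m n"] by auto
    then show "x + y \<in> (\<Union>n. cspan (e ` {..<n}))" by (blast intro: complex_vector.span_add)
  next
    fix c x assume "x \<in> (\<Union>n. cspan (e ` {..<n}))"
    then show "c *\<^sub>C x \<in> (\<Union>n. cspan (e ` {..<n}))" by (blast intro: complex_vector.span_scale)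
  qed
  moreover have "range e \<subseteq> (\<Union>n. cspan (e ` {..<n}))"
  proof clarify
    fix n
    have "e n \<in> cspan (e ` {..<Suc n})" by (rule complex_vector.span_base) auto
    then show "e n \<in> (\<Union>n. cspan (e ` {..<n}))" by blast
  qed
  ultimately show "cspan (range e) \<subseteq> (\<Union>n. cspan (e ` {..<n}))" by (rule complex_vector.span_minimal[rotated])
  show "(\<Union>n. cspan (e ` {..<n})) \<subseteq> cspan (range e)"
    by (intro UN_least complex_vector.span_mono) auto
qed

section \<open>Splitting T - a along the eigenvector sequence\<close>

locale positive_AN_operator =
  fixes T :: "'a::complex_hilbert \<Rightarrow> 'a" and e :: "nat \<Rightarrow> 'a" and a :: real
  assumes T: "T \<in> AN_ops" "positive_op T"
    and e_norm: "\<And>n. norm (e n) = 1" and e_eigen: "\<And>n. T (e n) = norm (T (e n)) *\<^sub>R e n"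
    and e_orth: "\<And>m n. m \<noteq> n \<Longrightarrow> cinner (e m) (e n) = 0"
    and e_top: "\<And>n x. x \<in> orth (e ` {..<n}) \<Longrightarrow> norm (T x) \<le> norm (T (e n)) * norm x"
    and a_lim: "(\<lambda>n. norm (T (e n))) \<longlonglongrightarrow> a" and a_le: "\<And>n. a \<le> norm (T (e n))"
begin

text \<open>T lies below a on M and above a on \<open>orth M\<close>, in the sense of forms. S
  preserves both subspaces, so cutting it along them gives operators K and F with products zero,
  which turn out to be its positive and negative part.\<close>

definition M :: "'a set" where "M = orth (range e)"

definition S :: "'a \<Rightarrow> 'a" where "S x = T x - a *\<^sub>R x"

definition K :: "'a \<Rightarrow> 'a" where "K x = S (x - proj M x)"

definition F :: "'a \<Rightarrow> 'a" where "F x = - S (proj M x)"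

lemma T_bounded: "T \<in> bounded_ops" and T_sym: "symmetric_op T" and T_pos: "0 \<le> Re (cinner (T x) x)"
  using T(2) by (auto simp: positive_op_iff)

lemmas T_lin = bounded_ops_clinear[OF T_bounded]

lemma a_nonneg: "0 \<le> a"
  using a_lim by (rule LIMSEQ_le_const) auto

lemma S_lin: "clinear_op S"
  by (rule clinear_opI)
     (simp_all add: S_def clinear_op_simps[OF T_lin] algebra_simps scaleC_of_real[symmetric] scaleC_scaleC
        complex_vector.scale_right_diff_distrib mult.commute)

lemma S_sym: "symmetric_op S"
  using symmetric_opD[OF T_sym] by (simp add: symmetric_op_def S_def cinner_simps)

lemma S_bounded: "S \<in> bounded_ops"
proof -
  obtain c where c: "0 < c" "\<And>x. norm (T x) \<le> c * norm x" using bounded_opsE[OF T_bounded] by blast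
  have "norm (S x) \<le> (c + a) * norm x" for x
    unfolding S_def using norm_triangle_ineq4[of "T x" "a *\<^sub>R x"] c(2)[of x] a_nonneg by (simp add: algebra_simps)
  then show ?thesis by (rule bounded_opsI[OF S_lin])
qed

lemma Re_S: "Re (cinner (S x) x) = Re (cinner (T x) x) - a * (norm x)\<^sup>2"
  by (simp add: S_def cinner_simps cinner_self del: of_real_power)

lemma S_eigen: "S (e n) = (norm (T (e n)) - a) *\<^sub>R e n"
  by (simp add: S_def scaleR_left_diff_distrib flip: e_eigen)

lemma M_sub: "csubspace M" and M_closed: "closed M"
  by (simp_all add: M_def csubspace_orth closed_orth)

lemma S_M: "x \<in> M \<Longrightarrow> S x \<in> M"
  unfolding M_def by (rule orth_eigenvectors_invariant[OF S_sym]) (auto intro: S_eigen)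

lemma S_orth_M: "x \<in> orth M \<Longrightarrow> S x \<in> orth M"
  by (rule orth_invariant[OF S_sym S_M])

text \<open>A vector of M is orthogonal to every initial segment of e, so each eigenvalue bounds T
  on it, and so does their limit.\<close>

lemma T_le_M:
  assumes x: "x \<in> M"
  shows "norm (T x) \<le> a * norm x"
proof (rule LIMSEQ_le_const)
  show "(\<lambda>n. norm (T (e n)) * norm x) \<longlonglongrightarrow> a * norm x"
    by (intro tendsto_mult_right a_lim)
  have "x \<in> orth (e ` {..<n})" for n using x by (auto simp: M_def orth_def)
  then show "\<exists>N. \<forall>n\<ge>N. norm (T x) \<le> norm (T (e n)) * norm x" using e_top by blast
qed

lemma S_nonpos_M: "x \<in> M \<Longrightarrow> Re (cinner (S x) x) \<le> 0"
  using form_le[of T x a, OF T_le_M] by (simp add: Re_S)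

lemma orth_M_eq: "orth M = closure (cspan (range e))"
  unfolding M_def using orth_orth[of "closure (cspan (range e))"]
  by (simp add: orth_closure orth_cspan csubspace_closure)

lemma S_nonneg_orth_M:
  assumes "x \<in> orth M"
  shows "0 \<le> Re (cinner (S x) x)"
proof -
  have "cspan (range e) \<subseteq> {x. 0 \<le> Re (cinner (S x) x)}"
    unfolding cspan_range_eq_Union
    using psd_on_eigenvector_span[OF S_lin S_sym e_orth S_eigen] a_le by auto
  moreover have "closed {x. 0 \<le> Re (cinner (S x) x)}"
    by (intro closed_Collect_le continuous_intros continuous_on_cinner
        linear_continuous_on bounded_ops_bounded_linear S_bounded)
  ultimately have "orth M \<subseteq> {x. 0 \<le> Re (cinner (S x) x)}"
    unfolding orth_M_eq by (rule closure_minimal)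
  then show ?thesis using assms by blast
qed

lemma proj_M: "proj M x \<in> M" and diff_proj_M: "x - proj M x \<in> orth M"
  by (rule proj_mem[OF M_sub M_closed], rule proj_orth[OF M_sub M_closed])

lemma proj_M_lin: "clinear_op (proj M)"
  by (rule clinear_op_proj[OF M_sub M_closed])

lemma K_minus_F: "K x - F x = S x"
  by (simp add: K_def F_def clinear_op_diff[OF S_lin])

lemma F_mem: "F x \<in> M"
  unfolding F_def by (intro complex_vector.subspace_neg M_sub S_M proj_M)

lemma K_mem: "K x \<in> orth M"
  unfolding K_def by (intro S_orth_M diff_proj_M)

lemma KF_zero: "K (F x) = 0" and FK_zero: "F (K x) = 0"
  by (simp_all add: K_def[of "F x"] F_def[of "K x"] proj_eq_self[OF M_sub M_closed F_mem]
      proj_eq_zero[OF M_sub M_closed K_mem] clinear_op_zero[OF S_lin])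

lemma cinner_S_proj: "cinner (S (proj M x)) y = cinner (S (proj M x)) (proj M y)"
proof -
  have "cinner (S (proj M x)) (y - proj M y) = 0" by (rule orthD'[OF diff_proj_M S_M[OF proj_M]])
  then show ?thesis by (simp add: cinner_diff_right)
qed

lemma F_positive: "positive_op F"
proof (rule positive_opI)
  obtain c where c: "0 < c" "\<And>x. norm (S x) \<le> c * norm x" using bounded_opsE[OF S_bounded] by blast
  have "norm (F x) \<le> c * norm x" for x
    unfolding F_def using c(2)[of "proj M x"] mult_left_mono[OF norm_proj_le[OF M_sub M_closed, of x], of c] c(1)
    by (simp only: norm_minus_cancel) linarith
  moreover have "clinear_op F"
    by (rule clinear_opI)
       (simp_all add: F_def clinear_op_simps[OF S_lin] clinear_op_simps[OF proj_M_lin])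
  ultimately show "F \<in> bounded_ops" by (rule bounded_opsI[rotated])
  show "symmetric_op F"
    unfolding symmetric_op_def
  proof (intro allI)
    fix x y
    have "cinner (S (proj M x)) y = cinner (proj M x) (S (proj M y))"
      unfolding cinner_S_proj[of x y] by (rule symmetric_opD[OF S_sym])
    also have "\<dots> = cinner x (S (proj M y))" by (metis cinner_S_proj cinner_commute)
    finally show "cinner (F x) y = cinner x (F y)" by (simp add: F_def cinner_simps)
  qed
  show "0 \<le> Re (cinner (F x) x)" for x
    using S_nonpos_M[OF proj_M, of x] by (simp add: F_def cinner_simps cinner_S_proj[of x x])
qed

lemma K_positive: "positive_op K"
proof (rule positive_opI)
  obtain c where c: "0 < c" "\<And>x. norm (S x) \<le> c * norm x" using bounded_opsE[OF S_bounded] by blast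
  have "norm (K x) \<le> c * norm x" for x
    unfolding K_def using c(2)[of "x - proj M x"] mult_left_mono[OF norm_diff_proj_le[OF M_sub M_closed, of x], of c] c(1)
    by linarith
  moreover have "clinear_op K"
    by (rule clinear_opI)
       (simp_all add: K_def clinear_op_simps[OF S_lin] clinear_op_simps[OF proj_M_lin]
          complex_vector.scale_right_diff_distrib)
  ultimately show "K \<in> bounded_ops" by (rule bounded_opsI[rotated])
  have KSF: "K x = S x + F x" for x using K_minus_F[of x] by (simp add: diff_eq_eq)
  show "symmetric_op K"
    using S_sym F_positive by (simp add: symmetric_op_def positive_op_iff KSF cinner_simps)
  show "0 \<le> Re (cinner (K x) x)" for x
  proof -
    have "cinner (K x) (proj M x) = 0" by (rule orthD[OF K_mem proj_M])
    then have "cinner (K x) x = cinner (K x) (x - proj M x)" by (simp add: cinner_diff_right)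
    then show ?thesis using S_nonneg_orth_M[OF diff_proj_M, of x] by (simp add: K_def)
  qed
qed

text \<open>Beyond the first n eigenvectors, S on \<open>orth M\<close> lies between 0 and
  \<open>norm (T (e n)) - a\<close>, which tends to 0. So K maps the unit ball close to the image
  under S of the unit ball of a finite dimensional span.\<close>

lemma K_compact: "K \<in> compact_ops"
proof (rule compact_opsI_approx)
  show "K \<in> bounded_ops" using K_positive by (simp add: positive_op_iff)
  fix \<epsilon> :: real assume \<epsilon>: "0 < \<epsilon>"
  obtain n where n: "norm (T (e n)) - a < \<epsilon>"
    using LIMSEQ_D[OF a_lim \<epsilon>] a_le by fastforce
  define E where "E = cspan (e ` {..<n})"
  have E: "csubspace E" "closed E" unfolding E_def by (simp_all add: closed_cspan_finite)
  have EM: "E \<subseteq> orth M"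
    unfolding E_def by (rule complex_vector.span_minimal[OF _ csubspace_orth]) (auto simp: M_def orth_def cinner_eq_zero_commute)
  define L where "L = orth M \<inter> orth (e ` {..<n})"
  have L: "csubspace L" unfolding L_def by (intro complex_vector.subspace_inter csubspace_orth)
  have SL: "norm (S x) \<le> (norm (T (e n)) - a) * norm x" if "x \<in> L" for x
  proof (rule psd_norm_le(2)[OF S_lin S_sym L])
    show "S z \<in> L" if "z \<in> L" for z
      using that S_orth_M orth_eigenvectors_invariant[OF S_sym, of "e ` {..<n}" z] S_eigen by (auto simp: L_def)
    show "0 \<le> Re (cinner (S z) z)" if "z \<in> L" for z using that S_nonneg_orth_M by (simp add: L_def)
    show "Re (cinner (S z) z) \<le> (norm (T (e n)) - a) * (norm z)\<^sup>2" if "z \<in> L" for z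
      using form_le[of T z, OF e_top, of n] that by (simp add: L_def Re_S algebra_simps)
  qed (use that a_le in auto)
  define C where "C = S ` (E \<inter> cball 0 1)"
  have "compact C"
    unfolding C_def E_def
    by (intro compact_continuous_image compact_cspan_Int_cball linear_continuous_on
        bounded_ops_bounded_linear S_bounded) simp
  moreover have "\<exists>y\<in>C. norm (K x - y) \<le> \<epsilon>" if x: "norm x \<le> 1" for x
  proof -
    define z where "z = x - proj M x"
    define q where "q = proj E z"
    have z: "z \<in> orth M" "norm z \<le> 1"
      unfolding z_def using diff_proj_M x norm_diff_proj_le[OF M_sub M_closed, of x] by auto
    have q: "q \<in> E" "norm q \<le> 1" "norm (z - q) \<le> 1"
      unfolding q_def using proj_mem[OF E] norm_proj_le[OF E, of z] norm_diff_proj_le[OF E, of z] z by auto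
    have "z - q \<in> orth M" using q(1) EM z(1) complex_vector.subspace_diff[OF csubspace_orth] by blast
    moreover have "z - q \<in> orth (e ` {..<n})"
      using proj_orth[OF E, of z] by (simp add: q_def E_def orth_cspan)
    ultimately have "norm (S (z - q)) \<le> (norm (T (e n)) - a) * norm (z - q)" by (intro SL) (simp add: L_def)
    also have "\<dots> \<le> \<epsilon> * 1" using n q(3) \<epsilon> by (intro mult_mono) auto
    finally have "norm (K x - S q) \<le> \<epsilon>" by (simp add: K_def z_def clinear_op_diff[OF S_lin])
    then show ?thesis using q by (auto simp: C_def)
  qed
  ultimately show "\<exists>C. compact C \<and> (\<forall>x. norm x \<le> 1 \<longrightarrow> (\<exists>y\<in>C. norm (K x - y) \<le> \<epsilon>))" by blast
qed

text \<open>\<open>M'\<close> is M with the eigenspace of a removed. If it were infinite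
  dimensional, a sequence f of eigenvectors in it would have no eigenvalue above that of
  \<open>f 0\<close>. Since these cannot be separated from the eigenvalues of e, the one of
  \<open>f 0\<close> is a, which puts \<open>f 0\<close> into the removed eigenspace.\<close>

lemma F_finite_rank: "F \<in> finite_rank_ops"
proof -
  define M0 where "M0 = M \<inter> {x. S x = 0}"
  have M0: "csubspace M0" "closed M0"
  proof -
    have "csubspace {x. S x = 0}"
      by (rule complex_vector.subspaceI) (auto simp: clinear_op_simps[OF S_lin])
    then show "csubspace M0" unfolding M0_def by (intro complex_vector.subspace_inter M_sub)
    show "closed M0" unfolding M0_def
      by (intro closed_Int M_closed closed_Collect_eq continuous_intros
          linear_continuous_on bounded_ops_bounded_linear S_bounded)
  qed
  define M' where "M' = M \<inter> orth M0"
  have M': "csubspace M'" "closed M'"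
    unfolding M'_def by (auto intro: complex_vector.subspace_inter M_sub csubspace_orth closed_Int M_closed closed_orth)
  have "cfinite_dim M'"
  proof (rule ccontr)
    assume inf: "\<not> cfinite_dim M'"
    have inv: "T x \<in> M'" if x: "x \<in> M'" for x
    proof -
      have "S x \<in> M" using x S_M by (simp add: M'_def)
      moreover have "S x \<in> orth M0"
      proof (rule orthI)
        show "cinner (S x) y = 0" if "y \<in> M0" for y
          using that by (simp add: symmetric_opD[OF S_sym] M0_def)
      qed
      ultimately have "S x + complex_of_real a *\<^sub>C x \<in> M'"
        using x M' by (intro complex_vector.subspace_add complex_vector.subspace_scale) (auto simp: M'_def)
      then show ?thesis by (simp add: S_def scaleC_of_real)
    qed
    obtain f where f: "\<And>n. f n \<in> M'" "\<And>n. norm (f n) = 1" "\<And>n. T (f n) = norm (T (f n)) *\<^sub>R f n"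
      "\<And>m n. m \<noteq> n \<Longrightarrow> cinner (f m) (f n) = 0"
      "\<And>n x. x \<in> M' \<Longrightarrow> x \<in> orth (f ` {..<n}) \<Longrightarrow> norm (T x) \<le> norm (T (f n)) * norm x"
      "decseq (\<lambda>n. norm (T (f n)))"
      by (rule AN_eigenvector_sequence[OF T M' inf inv]) (assumption, rule that)
    have fM: "f n \<in> M" for n using f(1)[of n] by (simp add: M'_def)
    have "a \<le> norm (T (f 0))"
    proof (rule AN_eigenvalues_not_separated[OF T(1) T_sym e_norm e_orth e_eigen f(2,4,3)])
      show "cinner (e m) (f n) = 0" for m n using fM[of n] unfolding M_def by (rule orthD') simp
      show "norm (T (f n)) \<le> norm (T (f 0))" for n using f(6) by (simp add: decseq_def)
    qed (simp_all add: a_le)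
    moreover have "norm (T (f 0)) \<le> a" using T_le_M[OF fM[of 0]] f(2)[of 0] by simp
    ultimately have "norm (T (f 0)) = a" by simp
    then have "S (f 0) = 0" using f(3)[of 0] by (simp add: S_def)
    then have "f 0 \<in> M0" using fM by (simp add: M0_def)
    then have "f 0 = 0" using f(1)[of 0] by (intro orth_Int_self[of _ M0]) (auto simp: M'_def)
    then show False using f(2)[of 0] by simp
  qed
  moreover have Fb: "F \<in> bounded_ops" using F_positive by (simp add: positive_op_iff)
  moreover have "range F = F ` M'"
  proof -
    have "F x \<in> F ` M'" for x
    proof -
      \<comment> \<open>S annihilates the component in \<open>M0\<close>, so subtracting it does not
        change the value of F.\<close>
      define p where "p = proj M0 (proj M x)"
      have p: "p \<in> M0" unfolding p_def by (rule proj_mem[OF M0])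
      have "proj M x - p \<in> M"
        using p by (intro complex_vector.subspace_diff M_sub proj_M) (simp add: M0_def)
      moreover have "proj M x - p \<in> orth M0" unfolding p_def by (rule proj_orth[OF M0])
      moreover have "F (proj M x - p) = F x"
        using p proj_eq_self[OF M_sub M_closed \<open>proj M x - p \<in> M\<close>]
        by (simp add: F_def clinear_op_diff[OF S_lin] M0_def)
      ultimately show ?thesis by (metis IntI M'_def imageI)
    qed
    then show ?thesis by blast
  qed
  ultimately show ?thesis
    using cfinite_dim_image[OF bounded_ops_clinear[OF Fb]] by (simp add: finite_rank_ops_def)
qed

text \<open>On M the form of \<open>- S = a - T\<close> lies between 0 and a; the upper bound is the
  positivity of T.\<close>

lemma onorm_F: "onorm F \<le> a"
proof (rule onorm_bound[OF a_nonneg])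
  fix x
  have "norm (- S (proj M x)) \<le> a * norm (proj M x)"
  proof (rule psd_norm_le(2)[where A = "\<lambda>x. - S x" and M = M])
    show "clinear_op (\<lambda>x. - S x)" by (rule clinear_opI) (simp_all add: clinear_op_simps[OF S_lin])
    show "symmetric_op (\<lambda>x. - S x)" using S_sym by (simp add: symmetric_op_def cinner_simps)
    show "- S z \<in> M" if "z \<in> M" for z using that by (intro complex_vector.subspace_neg M_sub S_M)
    show "0 \<le> Re (cinner (- S z) z)" if "z \<in> M" for z using S_nonpos_M[OF that] by (simp add: cinner_simps)
    show "Re (cinner (- S z) z) \<le> a * (norm z)\<^sup>2" for z using T_pos[of z] by (simp add: cinner_simps Re_S)
  qed (simp_all add: M_sub proj_M a_nonneg)
  also have "\<dots> \<le> a * norm x" by (intro mult_left_mono norm_proj_le M_sub M_closed a_nonneg)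
  finally show "norm (F x) \<le> a * norm x" by (simp add: F_def)
qed

lemma pos_neg_part_shift:
  "pos_part (\<lambda>x. T x - complex_of_real a *\<^sub>C x) = K" "neg_part (\<lambda>x. T x - complex_of_real a *\<^sub>C x) = F"
  by (rule pos_neg_part_eqI[OF K_positive F_positive _ KF_zero FK_zero],
      simp add: K_minus_F S_def scaleC_of_real)+

end

section \<open>Both implications of the equivalence\<close>

lemma positive_AN_decomposition:
  fixes T :: "'a::complex_hilbert \<Rightarrow> 'a"
  assumes inf: "\<not> cfinite_dim (UNIV :: 'a set)" and T: "T \<in> AN_ops" "positive_op T"
  shows "\<exists>a\<ge>0. pos_part (\<lambda>x. T x - complex_of_real a *\<^sub>C x) \<in> compact_ops\<^sub>+ \<and>
      neg_part (\<lambda>x. T x - complex_of_real a *\<^sub>C x) \<in> finite_rank_ops\<^sub>+ \<and>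
      onorm (neg_part (\<lambda>x. T x - complex_of_real a *\<^sub>C x)) \<le> a"
proof -
  \<comment> \<open>Infinite dimension enters here: the choice of eigenvectors on the whole space
    never stops.\<close>
  obtain e where e: "\<And>n. e n \<in> UNIV" "\<And>n. norm (e n) = 1" "\<And>n. T (e n) = norm (T (e n)) *\<^sub>R e n"
    "\<And>m n. m \<noteq> n \<Longrightarrow> cinner (e m) (e n) = 0"
    "\<And>n x. x \<in> UNIV \<Longrightarrow> x \<in> orth (e ` {..<n}) \<Longrightarrow> norm (T x) \<le> norm (T (e n)) * norm x"
    "decseq (\<lambda>n. norm (T (e n)))"
    by (rule AN_eigenvector_sequence[OF T complex_vector.subspace_UNIV closed_UNIV inf UNIV_I]) (rule that)
  obtain a where a: "(\<lambda>n. norm (T (e n))) \<longlonglongrightarrow> a" "\<And>n. a \<le> norm (T (e n))"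
    using decseq_convergent[OF e(6), of 0] by auto
  interpret positive_AN_operator T e a
    by unfold_locales (use T e a in auto)
  show ?thesis
    using a_nonneg K_compact K_positive F_finite_rank F_positive onorm_F
    by (intro exI[of _ a]) (simp add: pos_neg_part_shift positives_def)
qed

text \<open>\<open>pos_part S - neg_part S = S\<close> holds by the defining formulas, so T is a
  plus a compact positive operator minus a finite rank one. The norm bound makes T positive: the
  negative part takes at most \<open>a * (norm x)^2\<close> away from the form.\<close>

lemma positive_AN_of_decomposition:
  assumes T: "T \<in> bounded_ops" and a: "0 \<le> a"
    and K: "pos_part (\<lambda>x. T x - complex_of_real a *\<^sub>C x) \<in> compact_ops\<^sub>+"
    and F: "neg_part (\<lambda>x. T x - complex_of_real a *\<^sub>C x) \<in> finite_rank_ops\<^sub>+"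
    and le: "onorm (neg_part (\<lambda>x. T x - complex_of_real a *\<^sub>C x)) \<le> a"
  shows "T \<in> AN_ops\<^sub>+"
proof -
  define S where "S = (\<lambda>x. T x - complex_of_real a *\<^sub>C x)"
  have "(1/2) *\<^sub>C (y + z) - (1/2) *\<^sub>C (y - z) = z" for y z :: 'a
  proof -
    have "(1/2) *\<^sub>C (y + z) - (1/2) *\<^sub>C (y - z) = (1/2) *\<^sub>C ((y + z) - (y - z))"
      by (rule complex_vector.scale_right_diff_distrib[symmetric])
    also have "(y + z) - (y - z) = z + z" by simp
    also have "(1/2) *\<^sub>C (z + z) = z" using scaleC_of_real[of "1/2" "z + z"] by (simp flip: scaleR_2)
    finally show ?thesis .
  qed
  then have "pos_part S x - neg_part S x = S x" for x by (simp add: pos_part_def neg_part_def)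
  then have TKF: "T x = a *\<^sub>R x + pos_part S x - neg_part S x" for x
    by (simp add: S_def scaleC_of_real algebra_simps eq_diff_eq)
  have K': "pos_part S \<in> compact_ops" "positive_op (pos_part S)"
    and F': "neg_part S \<in> finite_rank_ops" "positive_op (neg_part S)"
    using K F by (auto simp: S_def positives_def)
  have "T \<in> AN_ops" by (rule AN_of_compact_finite_rank[OF T K' F' a TKF])
  moreover have "positive_op T"
  proof (rule positive_opI[OF T])
    show "symmetric_op T"
      using K' F' by (simp add: symmetric_op_def positive_op_iff TKF cinner_simps)
    fix x
    have "norm (neg_part S x) \<le> onorm (neg_part S) * norm x"
      using F' by (intro onorm bounded_ops_bounded_linear) (simp add: positive_op_iff)
    also have "\<dots> \<le> a * norm x" using le by (intro mult_right_mono) (simp_all add: S_def)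
    finally have "Re (cinner (neg_part S x) x) \<le> a * (norm x)\<^sup>2" by (rule form_le)
    moreover have "0 \<le> Re (cinner (pos_part S x) x)" using K' by (simp add: positive_op_iff)
    ultimately show "0 \<le> Re (cinner (T x) x)"
      by (simp add: TKF cinner_simps cinner_self del: of_real_power)
  qed
  ultimately show ?thesis by (simp add: positives_def)
qed

theorem theorem4p1:
  fixes T :: "'a::complex_hilbert \<Rightarrow> 'a"
  assumes "\<not> cfinite_dim (UNIV :: 'a set)"
    and "T \<in> bounded_ops"
  shows "T \<in> AN_ops\<^sub>+ \<longleftrightarrow>
    self_adjoint T \<and>
    (\<exists>\<alpha>::real. \<alpha> \<ge> 0 \<and>
      pos_part (\<lambda>x. T x - complex_of_real \<alpha> *\<^sub>C x) \<in> compact_ops\<^sub>+ \<and>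
      neg_part (\<lambda>x. T x - complex_of_real \<alpha> *\<^sub>C x) \<in> finite_rank_ops\<^sub>+ \<and>
      onorm (neg_part (\<lambda>x. T x - complex_of_real \<alpha> *\<^sub>C x)) \<le> \<alpha>)"
proof
  assume "T \<in> AN_ops\<^sub>+"
  then have T: "T \<in> AN_ops" "positive_op T" by (auto simp: positives_def)
  then show "self_adjoint T \<and>
    (\<exists>\<alpha>::real. \<alpha> \<ge> 0 \<and>
      pos_part (\<lambda>x. T x - complex_of_real \<alpha> *\<^sub>C x) \<in> compact_ops\<^sub>+ \<and>
      neg_part (\<lambda>x. T x - complex_of_real \<alpha> *\<^sub>C x) \<in> finite_rank_ops\<^sub>+ \<and>
      onorm (neg_part (\<lambda>x. T x - complex_of_real \<alpha> *\<^sub>C x)) \<le> \<alpha>)"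
    using positive_AN_decomposition[OF assms(1) T] by (simp add: positive_op_def)
next
  assume "self_adjoint T \<and>
    (\<exists>\<alpha>::real. \<alpha> \<ge> 0 \<and>
      pos_part (\<lambda>x. T x - complex_of_real \<alpha> *\<^sub>C x) \<in> compact_ops\<^sub>+ \<and>
      neg_part (\<lambda>x. T x - complex_of_real \<alpha> *\<^sub>C x) \<in> finite_rank_ops\<^sub>+ \<and>
      onorm (neg_part (\<lambda>x. T x - complex_of_real \<alpha> *\<^sub>C x)) \<le> \<alpha>)"
  then show "T \<in> AN_ops\<^sub>+"
    using positive_AN_of_decomposition[OF assms(2)] by blast
qed

end
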